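(* Let $n$ be an even positive integer and let $\ell$ be a positive integer such that $\ell\le 2^n/n$ and $\ell$ divides the number of edges of $Q_n$ (which is $n2^{n-1}$). Then there is an edge decomposition of $Q_n$ into paths of length $\ell$.
   Context: $Q_n$ denotes the $n$-dimensional hypercube: its vertex set is $\{0,1\}^n$ and two vertices are adjacent iff they differ in exactly one coordinate. An edge decomposition of a graph into subgraphs means the subgraphs are pairwise edge-disjoint and their union is the graph. The length of a path is its number of edges. *)

theory Defs
  imports Complex_Main
begin

text \<open>Undirected simple graphs: an edge is the two-element set of its endpoints.\<close>

record 'a graph =
  verts :: "'a set"
  edges :: "'a set set"

definition subgraph :: "'a graph \<Rightarrow> 'a graph \<Rightarrow> bool" where
  "subgraph H G \<longleftrightarrow> verts H \<subseteq> verts G \<and> edges H \<subseteq> edges G"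

definition edge_decomposition :: "'a graph \<Rightarrow> 'a graph set \<Rightarrow> bool" where
  "edge_decomposition G \<H> \<longleftrightarrow>
     (\<forall>H\<in>\<H>. subgraph H G) \<and>
     (\<forall>H\<in>\<H>. \<forall>H'\<in>\<H>. H \<noteq> H' \<longrightarrow> edges H \<inter> edges H' = {}) \<and>
     (\<Union>H\<in>\<H>. verts H) = verts G \<and>
     (\<Union>H\<in>\<H>. edges H) = edges G"

definition path_on :: "'a list \<Rightarrow> 'a graph" where
  "path_on vs = \<lparr>verts = set vs, edges = {{vs ! i, vs ! Suc i} | i. Suc i < length vs}\<rparr>"

text \<open>A path of length \<open>l\<close> (that is, with \<open>l\<close> edges) has \<open>l + 1\<close> distinct vertices.\<close>

definition is_path :: "nat \<Rightarrow> 'a graph \<Rightarrow> bool" where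
  "is_path l P \<longleftrightarrow> (\<exists>vs. distinct vs \<and> length vs = Suc l \<and> P = path_on vs)"

definition hypercube :: "nat \<Rightarrow> bool list graph" where
  "hypercube n =
     \<lparr>verts = {x. length x = n},
      edges = {{x, y} | x y. length x = n \<and> length y = n \<and> card {i. i < n \<and> x ! i \<noteq> y ! i} = 1}\<rparr>"

lemma card_verts_hypercube: "card (verts (hypercube n)) = 2 ^ n"
  using card_lists_length_eq[of "UNIV :: bool set" n] by (simp add: hypercube_def)

lemma edges_hypercube_flip:
  "edges (hypercube n) =
     (\<lambda>(i, x). {x, x[i := True]}) ` {(i, x). i < n \<and> length x = n \<and> \<not> x ! i}"
  (is "_ = ?f ` ?S")
proof (intro equalityI subsetI)
  fix e assume "e \<in> edges (hypercube n)"
  then obtain x y i where e: "e = {x, y}" "length x = n" "length y = n"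
    and "{i. i < n \<and> x ! i \<noteq> y ! i} = {i}"
    by (auto simp: hypercube_def card_1_singleton_iff)
  then have i: "i < n" "x ! i \<noteq> y ! i" and eq: "\<And>j. j < n \<Longrightarrow> j \<noteq> i \<Longrightarrow> x ! j = y ! j"
    by blast+
  show "e \<in> ?f ` ?S"
  proof (cases "x ! i")
    case False
    with i e eq have "y = x[i := True]"
      by (intro nth_equalityI) (auto simp: nth_list_update)
    with False i e show ?thesis by (auto intro!: image_eqI[where x = "(i, x)"])
  next
    case True
    with i e eq have "x = y[i := True]"
      by (intro nth_equalityI) (auto simp: nth_list_update)
    with True i e show ?thesis by (auto intro!: image_eqI[where x = "(i, y)"])
  qed
next
  fix e assume "e \<in> ?f ` ?S"
  then obtain i x where *: "e = {x, x[i := True]}" "i < n" "length x = n" "\<not> x ! i"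
    by auto
  then have "{j. j < n \<and> x ! j \<noteq> x[i := True] ! j} = {i}"
    by (auto simp: nth_list_update split: if_splits)
  then have "card {j. j < n \<and> x ! j \<noteq> x[i := True] ! j} = 1" by simp
  moreover have "length (x[i := True]) = n" using * by simp
  ultimately show "e \<in> edges (hypercube n)"
    using * unfolding hypercube_def by (simp only: graph.simps mem_Collect_eq) blast
qed

lemma card_edges_hypercube: "card (edges (hypercube n)) = n * 2 ^ (n - 1)"
proof -
  let ?f = "\<lambda>(i, x). {x, x[i := True]} :: bool list set"
  let ?L = "\<lambda>i. {x :: bool list. length x = n \<and> \<not> x ! i}"
  have fin: "finite {x :: bool list. length x = n}"
    using finite_lists_length_eq[of "UNIV :: bool set" n] by simp
  have "inj_on ?f {(i, x). i < n \<and> length x = n \<and> \<not> x ! i}"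
  proof (rule inj_onI)
    fix p q :: "nat \<times> bool list"
    assume pq: "p \<in> {(i, x). i < n \<and> length x = n \<and> \<not> x ! i}"
      "q \<in> {(i, x). i < n \<and> length x = n \<and> \<not> x ! i}" "?f p = ?f q"
    obtain i x j y where ij: "p = (i, x)" "q = (j, y)" by (metis surj_pair)
    with pq have *: "{x, x[i := True]} = {y, y[j := True]}" "i < length x" "\<not> x ! i"
      "j < length y" "\<not> y ! j" "length y = length x" by simp_all
    have ne: "x \<noteq> y[j := True] \<or> y \<noteq> x[i := True]"
      using * by (metis nth_list_update_eq nth_list_update_neq)
    then have xy: "x = y" "x[i := True] = y[j := True]"
      using *(1) by (auto simp: doubleton_eq_iff)
    then have "i = j" using * by (metis nth_list_update_eq nth_list_update_neq)
    with xy ij show "p = q" by simp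
  qed
  then have "card (edges (hypercube n)) = card (Sigma {..<n} ?L)"
    by (simp add: edges_hypercube_flip card_image)
      (rule arg_cong[where f = card], auto)
  also have "\<dots> = (\<Sum>i<n. card (?L i))"
    using fin by (intro card_SigmaI) (auto intro: finite_subset)
  also have "\<dots> = (\<Sum>i<n. 2 ^ (n - 1))"
  proof (rule sum.cong[OF refl])
    fix i assume "i \<in> {..<n}"
    then have i: "i < n" by simp
    let ?U = "{x :: bool list. length x = n \<and> x ! i}"
    have "bij_betw (\<lambda>x. x[i := True]) (?L i) ?U"
      by (rule bij_betw_byWitness[where f' = "\<lambda>x. x[i := False]"])
        (use i in \<open>auto simp: list_update_same_conv\<close>)
    then have "card (?L i) = card ?U" by (rule bij_betw_same_card)
    moreover have "card (?L i) + card ?U = card {x :: bool list. length x = n}"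
      using fin by (subst card_Un_disjoint[symmetric])
        (auto intro: finite_subset intro!: arg_cong[where f = card])
    moreover have "card {x :: bool list. length x = n} = 2 * 2 ^ (n - 1)"
      using card_verts_hypercube[of n] i by (cases n) (simp_all add: hypercube_def)
    ultimately show "card (?L i) = 2 ^ (n - 1)" by simp
  qed
  finally show ?thesis by simp
qed

end

theory Submission
  imports Defs
begin

text \<open>For even \<open>n\<close> the cube splits into Hamiltonian cycles, by induction: the cube of dimension
  \<open>k + m\<close> is the product of two smaller cubes, where \<open>k = m\<close> or \<open>k = m + 2\<close>, both even. A cycle of the
  first factor times a cycle of the second one is a torus, which splits into two Hamiltonian
  cycles; if the first factor has one cycle more than the second one, then one product of two
  cycles by one cycle has to be split into three.

  For \<open>n \<ge> 6\<close>, view the cube as the product of the cube of dimension \<open>n - 2\<close> and a 4-cycle,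
  and follow one Hamiltonian cycle of the former, zigzagging between layers of the latter, with
  a detour through each of the other Hamiltonian cycles. The four translates of this walk
  partition the edges, and each returns to a vertex only after more than \<open>l\<close> steps, so it can be
  cut into paths of length \<open>l\<close>. For \<open>n \<le> 4\<close> the Hamiltonian cycles themselves can be cut.

  Disjointness of edge sets never has to be checked: it follows from covering all edges with
  the right total number of edges.\<close>

section \<open>Edges of walks and cycles\<close>

text \<open>Hamiltonian cycles alone do not suffice: cutting one needs \<open>l\<close> to divide
  \<open>2 ^ n\<close>, while \<open>l\<close> may carry odd factors of \<open>n div 2\<close>. A
  closed walk that uses every Hamiltonian cycle of the cube of dimension \<open>n - 2\<close> once,
  and one edge of the 4-cycle over each vertex, has \<open>(n div 2) * 2 ^ (n - 2)\<close> edges, a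
  quarter of the cube. The bound \<open>n * l \<le> 2 ^ n\<close> limits the power of 2 in
  \<open>l\<close> enough for \<open>l\<close> to divide that length. A detour revisits the vertex
  through which it entered its layer. Orienting its cycle suitably delays this by at least half of
  \<open>2 ^ (n - 2)\<close> steps, so the construction needs
  \<open>2 * l \<le> 2 ^ (n - 2)\<close>. This follows from the bound for \<open>n \<ge> 8\<close>,
  and from the bound together with divisibility for \<open>n = 6\<close>. In the split into three
  cycles, rerouting two columns of the torus breaks one cycle into two; exchanging arcs with the
  diagonal cycle in one square repairs this.\<close>

abbreviation wedges :: "'a list \<Rightarrow> 'a set set" where
  "wedges xs \<equiv> edges (path_on xs)"

text \<open>A cycle is stored without repeating its first vertex. No adjacency of consecutive
  entries is built in, so the notation serves indices, torus points and cube vertices alike.\<close>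

definition cedges :: "'a list \<Rightarrow> 'a set set" where
  "cedges xs = insert {last xs, hd xs} (wedges xs)"

lemma wedges_altdef: "wedges xs = (\<lambda>i. {xs ! i, xs ! Suc i}) ` {i. Suc i < length xs}"
  by (auto simp: path_on_def)

lemma wedges_Nil [simp]: "wedges [] = {}"
  and wedges_single [simp]: "wedges [x] = {}"
  by (auto simp: path_on_def)

lemma wedges_Cons: "ys \<noteq> [] \<Longrightarrow> wedges (x # ys) = insert {x, hd ys} (wedges ys)"
proof -
  assume ys: "ys \<noteq> []"
  have "{i. i < k} = insert 0 (Suc ` {i. Suc i < k})" if "0 < k" for k
    using that by (force simp: image_iff gr0_conv_Suc less_Suc_eq_0_disj)
  then have "{i. Suc i < length (x # ys)} = insert 0 (Suc ` {i. Suc i < length ys})"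
    using ys by simp
  then show ?thesis
    using ys by (simp add: wedges_altdef image_image hd_conv_nth)
qed

lemma wedges_Cons_Cons [simp]: "wedges (x # y # ys) = insert {x, y} (wedges (y # ys))"
  by (simp add: wedges_Cons)

lemma wedges_append:
  "xs \<noteq> [] \<Longrightarrow> ys \<noteq> [] \<Longrightarrow>
    wedges (xs @ ys) = insert {last xs, hd ys} (wedges xs \<union> wedges ys)"
  by (induction xs rule: induct_list012) (auto simp: wedges_Cons)

lemma wedges_append_subset: "wedges xs \<union> wedges ys \<subseteq> wedges (xs @ ys)"
  by (cases "xs = []"; cases "ys = []") (auto simp: wedges_append)

lemma wedges_rev [simp]: "wedges (rev xs) = wedges xs"
proof (induction xs)
  case (Cons x xs)
  then show ?case
    by (cases "xs = []") (auto simp: wedges_append wedges_Cons last_rev insert_commute)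
qed simp

lemma wedges_map: "wedges (map f xs) = (`) f ` wedges xs"
  by (force simp: wedges_altdef image_image image_iff)

lemma wedges_nth: "Suc i < length xs \<Longrightarrow> {xs ! i, xs ! Suc i} \<in> wedges xs"
  by (auto simp: path_on_def)

lemma finite_wedges [simp]: "finite (wedges xs)"
proof -
  have "{i. Suc i < length xs} = {..<length xs - 1}" by auto
  then show ?thesis by (simp add: wedges_altdef)
qed

lemma wedges_subset: "e \<in> wedges xs \<Longrightarrow> e \<subseteq> set xs"
  by (auto simp: path_on_def)

lemma card_wedges_le: "card (wedges xs) \<le> length xs - 1"
proof -
  have "{i. Suc i < length xs} = {..<length xs - 1}" by auto
  then have "wedges xs = (\<lambda>i. {xs ! i, xs ! Suc i}) ` {..<length xs - 1}"
    by (simp only: wedges_altdef)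
  then show ?thesis
    using card_image_le[of "{..<length xs - 1}" "\<lambda>i. {xs ! i, xs ! Suc i}"] by simp
qed

lemma wedges_concat:
  assumes "\<And>i. i \<in> {a..<b} \<Longrightarrow> f i \<noteq> []"
  shows "i \<in> {a..<b} \<Longrightarrow> wedges (f i) \<subseteq> wedges (concat (map f [a..<b]))"
    and "a \<le> i \<Longrightarrow> Suc i < b \<Longrightarrow> {last (f i), hd (f (Suc i))} \<in> wedges (concat (map f [a..<b]))"
proof -
  show "wedges (f i) \<subseteq> wedges (concat (map f [a..<b]))" if "i \<in> {a..<b}" for i
  proof -
    from that have "[a..<b] = [a..<i] @ i # [Suc i..<b]"
      by (metis atLeastLessThan_iff le_Suc_ex less_imp_le_nat upt_add_eq_append upt_conv_Cons)
    then have "concat (map f [a..<b]) =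
        concat (map f [a..<i]) @ f i @ concat (map f [Suc i..<b])" by simp
    then show ?thesis using wedges_append_subset by (metis le_sup_iff subset_trans)
  qed
  show "{last (f i), hd (f (Suc i))} \<in> wedges (concat (map f [a..<b]))"
    if "a \<le> i" "Suc i < b" for i
  proof -
    from that have "[a..<b] = [a..<i] @ i # Suc i # [Suc (Suc i)..<b]"
      by (metis Suc_lessD le_Suc_ex less_imp_le_nat upt_add_eq_append upt_conv_Cons)
    then have "concat (map f [a..<b]) =
        concat (map f [a..<i]) @ (f i @ f (Suc i)) @ concat (map f [Suc (Suc i)..<b])" by simp
    moreover have "{last (f i), hd (f (Suc i))} \<in> wedges (f i @ f (Suc i))"
      using assms that by (subst wedges_append) auto
    ultimately show ?thesis using wedges_append_subset by (metis Un_iff subset_iff)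
  qed
qed

lemma cedges_append:
  "xs \<noteq> [] \<Longrightarrow> ys \<noteq> [] \<Longrightarrow> cedges (xs @ ys) =
    insert {last xs, hd ys} (insert {last ys, hd xs} (wedges xs \<union> wedges ys))"
  by (auto simp: cedges_def wedges_append)

lemma cedges_swap: "cedges (xs @ ys) = cedges (ys @ xs)"
  by (cases "xs = []"; cases "ys = []") (auto simp: cedges_append)

lemma cedges_rotate [simp]: "cedges (rotate k xs) = cedges xs"
  by (metis append_take_drop_id cedges_swap rotate_drop_take)

lemma cedges_rev [simp]: "cedges (rev xs) = cedges xs"
  by (cases "xs = []") (auto simp: cedges_def hd_rev last_rev insert_commute)

lemma cedges_map: "xs \<noteq> [] \<Longrightarrow> cedges (map f xs) = (`) f ` cedges xs"
  by (simp add: cedges_def wedges_map hd_map last_map)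

lemma finite_cedges [simp]: "finite (cedges xs)"
  by (simp add: cedges_def)

lemma card_cedges_le: "xs \<noteq> [] \<Longrightarrow> card (cedges xs) \<le> length xs"
  using card_wedges_le[of xs] unfolding cedges_def
  by (cases xs) (auto simp: card_insert_if)

lemma wedges_cedges: "e \<in> wedges xs \<Longrightarrow> e \<in> cedges xs"
  and last_hd_cedges: "{last xs, hd xs} \<in> cedges xs"
  by (auto simp: cedges_def)

lemma cedges_subset: "xs \<noteq> [] \<Longrightarrow> e \<in> cedges xs \<Longrightarrow> e \<subseteq> set xs"
  by (auto simp: cedges_def dest: wedges_subset)

lemma cedges_nth:
  assumes "i < length xs" shows "{xs ! i, xs ! (Suc i mod length xs)} \<in> cedges xs"
proof (cases "Suc i < length xs")
  case True then show ?thesis by (simp add: cedges_def wedges_nth)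
next
  case False
  with assms have "Suc i = length xs" by simp
  with assms show ?thesis
    by (metis cedges_def hd_conv_nth insertI1 last_conv_nth length_0_conv less_nat_zero_code
        mod_self diff_Suc_1)
qed

lemma cedges_conv_nth:
  assumes "xs \<noteq> []"
  shows "cedges xs = (\<lambda>i. {xs ! i, xs ! (Suc i mod length xs)}) ` {..<length xs}"
proof -
  have "cedges xs \<subseteq> (\<lambda>i. {xs ! i, xs ! (Suc i mod length xs)}) ` {..<length xs}"
    using assms unfolding cedges_def wedges_altdef
    by (auto simp: image_iff last_conv_nth hd_conv_nth intro!: bexI[of _ "length xs - 1"])
  then show ?thesis using cedges_nth by (auto simp: image_subset_iff)
qed

text \<open>Replacing the two arcs of a cycle through parallel sides of a square by the other two
  sides leaves a single cycle if the arcs point the same way, and joins two cycles whatever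
  the directions are.\<close>

lemma cedges_exchange:
  assumes "P \<noteq> []" "Q \<noteq> []" "R \<noteq> []" "S \<noteq> []"
    and "last P = a" "hd Q = b" "last Q = c" "hd P = d"
    and "last R = a" "hd R = c" "last S = b" "hd S = d"
  shows "cedges (P @ rev Q) \<union> cedges (R @ rev S) = cedges (P @ Q) \<union> cedges R \<union> cedges S"
proof -
  have *: "{c, a} = {a, c}" "{d, b} = {b, d}" "{c, d} = {d, c}" "{b, a} = {a, b}"
    by (simp_all add: insert_commute)
  show ?thesis
    using assms * unfolding cedges_def[of R] cedges_def[of S]
    by (simp add: cedges_append hd_rev last_rev) blast
qed

lemma rotate_to_hd:
  assumes "x \<in> set xs" shows "\<exists>k. hd (rotate k xs) = x"
proof -
  from assms obtain k where "k < length xs" "xs ! k = x" by (meson in_set_conv_nth)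
  then have "hd (rotate k xs) = x"
    by (metis append_take_drop_id drop_eq_Nil hd_append2 hd_drop_conv_nth leD mod_less
        rotate_drop_take)
  then show ?thesis by blast
qed

section \<open>Two cycles in a torus\<close>

text \<open>The torus \<open>\<int>\<^sub>A \<times> \<int>\<^sub>B\<close>, with \<open>B\<close> dividing \<open>A\<close>, splits into two cycles: \<open>diag_cycle\<close> moves in
  the first coordinate except on the antidiagonal \<open>i + c \<equiv> - 1\<close> (mod \<open>B\<close>), where it moves in the
  second one; the columns \<open>col i\<close>, joined along that antidiagonal, use all other edges.\<close>

definition diag_pos :: "nat \<Rightarrow> nat \<Rightarrow> nat \<Rightarrow> nat \<times> nat" where
  "diag_pos A B t = ((t - t div B) mod A, (t div B) mod B)"

definition diag_cycle :: "nat \<Rightarrow> nat \<Rightarrow> (nat \<times> nat) list" where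
  "diag_cycle A B = map (diag_pos A B) [0..<A * B]"

text \<open>In natural numbers, \<open>(B - 1) * i\<close> stands for \<open>- i\<close> modulo
  \<open>B\<close>. Column \<open>i\<close> thus starts where \<open>i + c\<close> is 0 and ends
  where it is -1 modulo \<open>B\<close>, so one step in the first coordinate leads from its end to
  the start of the next column.\<close>

definition col :: "nat \<Rightarrow> nat \<Rightarrow> (nat \<times> nat) list" where
  "col B i = map (\<lambda>r. (i, (r + (B - 1) * i) mod B)) [0..<B]"

lemma mod_pred_mult: "0 < B \<Longrightarrow> (x + i + (B - 1) * i) mod B = x mod (B::nat)"
proof -
  assume "0 < B"
  then have *: "x + i + (B - 1) * i = x + B * i" by (cases B) simp_all
  show "(x + i + (B - 1) * i) mod B = x mod B" unfolding * by simp
qed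

lemma mod_eq_pred_iff: "0 < B \<Longrightarrow> x mod B = B - 1 \<longleftrightarrow> Suc x mod B = (0::nat)"
  by (auto simp: mod_Suc)

lemma nat_mod_eq_iff_dvd: "x mod B = y mod B \<longleftrightarrow> int B dvd int x - int y" for x y B :: nat
proof -
  have "x mod B = y mod B \<longleftrightarrow> int (x mod B) = int (y mod B)" by simp
  also have "\<dots> \<longleftrightarrow> int x mod int B = int y mod int B" by (simp only: zmod_int)
  finally show ?thesis by (simp only: mod_eq_dvd_iff)
qed

lemma mod_eq_dvd_weaken: "x mod A = y mod A \<Longrightarrow> B dvd A \<Longrightarrow> x mod B = y mod (B::nat)"
  by (metis mod_mod_cancel)

lemma add_left_mod_cancel: "(k + x) mod B = (k + y) mod B \<longleftrightarrow> x mod B = y mod (B::nat)"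
  by (simp add: nat_mod_eq_iff_dvd)

lemma length_col [simp]: "length (col B i) = B" by (simp add: col_def)

lemma col_nonempty [simp]: "0 < B \<Longrightarrow> col B i \<noteq> []" by (metis length_0_conv length_col less_irrefl)

lemma set_col:
  assumes "0 < B" shows "set (col B i) = {i} \<times> {..<B}"
proof -
  have "inj_on (\<lambda>r. (r + (B - 1) * i) mod B) {..<B}"
    by (rule inj_onI) (metis add.commute add_left_mod_cancel lessThan_iff mod_less)
  then have "(\<lambda>r. (r + (B - 1) * i) mod B) ` {..<B} = {..<B}"
    by (rule endo_inj_surj[OF finite_lessThan, rotated]) (use assms in auto)
  moreover have "set (col B i) = Pair i ` (\<lambda>r. (r + (B - 1) * i) mod B) ` {..<B}"
    by (simp add: col_def image_image atLeast0LessThan)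
  ultimately show ?thesis by auto
qed

lemma col_nth:
  assumes "c < B" "(i + c) mod B = r"
  shows "col B i ! r = (i, c)"
proof -
  have B: "0 < B" using assms by linarith
  then have r: "r < B" using assms by auto
  have "(i + (r + (B - 1) * i)) mod B = (i + c) mod B"
    using mod_pred_mult[of B r i] B assms(2) mod_mod_trivial[of "i + c" B]
    by (simp add: ac_simps)
  then have "(r + (B - 1) * i) mod B = c mod B" by (simp only: add_left_mod_cancel)
  then have "(r + (B - 1) * i) mod B = c" using assms(1) by simp
  then show ?thesis using r by (simp add: col_def)
qed

lemma hd_col: "c < B \<Longrightarrow> (i + c) mod B = 0 \<Longrightarrow> hd (col B i) = (i, c)"
  using col_nth[of c B i 0] by (simp add: hd_conv_nth)

lemma last_col: "c < B \<Longrightarrow> (i + c) mod B = B - 1 \<Longrightarrow> last (col B i) = (i, c)"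
  using col_nth[of c B i "B - 1"] by (simp add: last_conv_nth)

lemma wedges_col:
  assumes B: "0 < B" "c < B" "(i + c) mod B \<noteq> B - 1"
  shows "{(i, c), (i, Suc c mod B)} \<in> wedges (col B i)"
proof -
  define r where "r = (i + c) mod B"
  have r: "Suc r < B"
    using B mod_less_divisor[OF B(1), of "i + c"] unfolding r_def by linarith
  then have "(i + Suc c mod B) mod B = Suc r"
    by (simp add: r_def mod_simps) (simp add: mod_Suc)
  then show ?thesis
    using wedges_nth[of r "col B i"] r B col_nth[of c B i r] col_nth[of "Suc c mod B" B i "Suc r"]
    by (simp add: r_def)
qed

context
  fixes A B :: nat
  assumes B0: "2 \<le> B" and dvd: "B dvd A" and A0: "0 < A" and cop: "coprime (B - 1) A"
begin

text \<open>Write \<open>t = B * q + r\<close>. The first coordinate is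
  \<open>(B - 1) * q + r\<close> modulo \<open>A\<close>, the second is \<open>q\<close> modulo
  \<open>B\<close>. As \<open>B\<close> divides \<open>A\<close>, both together determine
  \<open>r\<close>; then coprimality of \<open>B - 1\<close> and \<open>A\<close> determines
  \<open>q\<close> modulo \<open>A\<close>, and \<open>q < A\<close>.\<close>

lemma diag_pos_inj:
  assumes eq: "diag_pos A B s = diag_pos A B t" and st: "s < A * B" "t < A * B"
  shows "s = t"
proof -
  let ?q = "s div B" and ?q' = "t div B"
  have *: "u - u div B = (B - 1) * (u div B) + u mod B" for u
  proof -
    have "u = B * (u div B) + u mod B" by simp
    moreover have "B * (u div B) = (B - 1) * (u div B) + u div B"
      using B0 by (cases B) auto
    ultimately show ?thesis by linarith
  qed
  note s = *[of s] and t = *[of t]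
  have e1: "((B - 1) * ?q + s mod B) mod A = ((B - 1) * ?q' + t mod B) mod A"
    and e2: "?q mod B = ?q' mod B"
    using eq unfolding diag_pos_def s t by simp_all
  from e1 have "((B - 1) * ?q + s mod B) mod B = ((B - 1) * ?q' + t mod B) mod B"
    using dvd by (rule mod_eq_dvd_weaken)
  moreover have "((B - 1) * ?q) mod B = ((B - 1) * ?q') mod B"
    using mod_mult_cong[OF refl e2] by blast
  ultimately have r: "s mod B = t mod B"
    by (metis (no_types) add_left_mod_cancel mod_add_left_eq mod_mod_trivial)
  have "int A dvd int (B - 1) * (int ?q - int ?q')"
    using e1 r by (simp add: nat_mod_eq_iff_dvd right_diff_distrib del: of_nat_diff)
  moreover have "coprime (int A) (int (B - 1))" using cop by (simp add: coprime_commute)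
  ultimately have "int A dvd int ?q - int ?q'" by (simp add: coprime_dvd_mult_right_iff)
  then have "?q mod A = ?q' mod A" by (simp only: nat_mod_eq_iff_dvd)
  moreover have "?q < A" "?q' < A"
    using st by (simp_all only: less_mult_imp_div_less)
  ultimately have "?q = ?q'" by (simp only: mod_less)
  then have "?q * B + s mod B = ?q' * B + t mod B" using r by (simp only:)
  then show "s = t" by (simp only: div_mult_mod_eq)
qed

lemma length_diag_cycle [simp]: "length (diag_cycle A B) = A * B"
  by (simp add: diag_cycle_def)

lemma distinct_diag_cycle: "distinct (diag_cycle A B)"
  using diag_pos_inj by (auto simp: diag_cycle_def distinct_map intro!: inj_onI)

lemma set_diag_cycle: "set (diag_cycle A B) = {..<A} \<times> {..<B}"
proof (rule card_subset_eq)
  show "set (diag_cycle A B) \<subseteq> {..<A} \<times> {..<B}"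
    using A0 B0 by (auto simp: diag_cycle_def diag_pos_def)
  show "card (set (diag_cycle A B)) = card ({..<A} \<times> {..<B})"
    by (simp add: distinct_card distinct_diag_cycle)
qed auto

text \<open>The coordinates count the moves made in the two directions, so \<open>i + c\<close> is
  congruent to \<open>t\<close> modulo \<open>B\<close>. Hence the steps that increase
  \<open>t div B\<close> are exactly those starting on the antidiagonal.\<close>

lemma diag_pos_Suc:
  assumes "diag_pos A B t = (i, c)"
  shows "diag_pos A B (Suc t) =
    (if (i + c) mod B = B - 1 then (i, Suc c mod B) else (Suc i mod A, c))"
proof -
  have i: "i = (t - t div B) mod A" and c: "c = (t div B) mod B"
    using assms by (simp_all add: diag_pos_def)
  have le: "t div B \<le> t" by simp
  have "(i + c) mod B = ((t - t div B) mod A mod B + t div B) mod B"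
    by (simp add: i c mod_simps)
  also have "\<dots> = t mod B"
    using dvd le by (simp add: mod_mod_cancel mod_simps)
  finally have *: "(i + c) mod B = t mod B" .
  show ?thesis
  proof (cases "t mod B = B - 1")
    case True
    then have "Suc t div B = Suc (t div B)" using B0 by (simp add: div_Suc mod_Suc)
    then show ?thesis using True * by (simp add: diag_pos_def i c mod_Suc_eq)
  next
    case False
    then have "Suc t div B = t div B" using B0 by (simp add: div_Suc mod_Suc)
    moreover have "Suc t - t div B = Suc (t - t div B)" using le by (rule Suc_diff_le)
    ultimately show ?thesis using False * by (simp add: diag_pos_def i c mod_Suc_eq)
  qed
qed

lemma diag_pos_period: "diag_pos A B (A * B) = diag_pos A B 0"
proof -
  have "A * B - A = (B - 1) * A" using B0 by (simp add: algebra_simps)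
  then show ?thesis using B0 dvd by (simp add: diag_pos_def)
qed

lemma diag_cycle_arc:
  assumes "i < A" "c < B"
  obtains t where "t < A * B" "diag_pos A B t = (i, c)"
proof -
  have "(i, c) \<in> set (diag_cycle A B)" using assms by (simp add: set_diag_cycle)
  then show ?thesis using that by (auto simp: diag_cycle_def)
qed

lemma cedges_diag_cycle:
  assumes "i < A" "c < B"
  shows "{(i, c), if (i + c) mod B = B - 1 then (i, Suc c mod B) else (Suc i mod A, c)}
    \<in> cedges (diag_cycle A B)"
proof -
  obtain t where t: "t < A * B" "diag_pos A B t = (i, c)" using assms by (rule diag_cycle_arc)
  have "diag_pos A B (Suc t mod (A * B)) = diag_pos A B (Suc t)"
    using t(1) diag_pos_period by (cases "Suc t = A * B") auto
  moreover have "Suc t mod (A * B) < A * B" using t(1) by (intro mod_less_divisor) linarith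
  ultimately show ?thesis
    using cedges_nth[of t "diag_cycle A B"] t diag_pos_Suc[OF t(2)] by (simp add: diag_cycle_def)
qed

lemma torus_two_cycles:
  obtains Z1 Z2 :: "(nat \<times> nat) list" where
    "distinct Z1" "set Z1 = {..<A} \<times> {..<B}" "distinct Z2" "set Z2 = {..<A} \<times> {..<B}"
    "\<And>i c. i < A \<Longrightarrow> c < B \<Longrightarrow> {(i, c), (Suc i mod A, c)} \<in> cedges Z1 \<union> cedges Z2"
    "\<And>i c. i < A \<Longrightarrow> c < B \<Longrightarrow> {(i, c), (i, Suc c mod B)} \<in> cedges Z1 \<union> cedges Z2"
proof
  let ?Z = "concat (map (col B) [0..<A])"
  have B: "0 < B" using B0 by simp
  show "distinct (diag_cycle A B)" "set (diag_cycle A B) = {..<A} \<times> {..<B}"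
    by (fact distinct_diag_cycle set_diag_cycle)+
  show s: "set ?Z = {..<A} \<times> {..<B}" using B by (auto simp: set_col)
  have "length ?Z = A * B" by (simp add: length_concat comp_def sum_list_triv)
  \<comment> \<open>Distinctness comes from counting too: a list of length \<open>A * B\<close> that
    hits \<open>A * B\<close> elements has no repetition.\<close>
  then show "distinct ?Z" by (intro card_distinct) (simp only: s card_cartesian_product card_lessThan)
  have ne: "col B i \<noteq> []" for i using B by simp
  show "{(i, c), (Suc i mod A, c)} \<in> cedges (diag_cycle A B) \<union> cedges ?Z"
    if ic: "i < A" "c < B" for i c
  proof (cases "(i + c) mod B = B - 1")
    case True
    then have l: "last (col B i) = (i, c)" using ic B by (simp add: last_col)
    from True have 0: "(Suc i + c) mod B = 0" using mod_eq_pred_iff[OF B, of "i + c"] by simp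
    show ?thesis
    proof (cases "Suc i < A")
      case True
      then show ?thesis
        using wedges_concat(2)[of 0 A "col B" i] ne l hd_col[OF ic(2) 0]
        by (auto dest: wedges_cedges)
    next
      case False
      with ic have A: "A = Suc i" by simp
      then have "c mod B = 0" using 0 dvd by (metis add.commute add.right_neutral dvd_imp_mod_0 mod_add_right_eq)
      then have "c = 0" using ic by simp
      have "last ?Z = (i, c)" using A l ne by simp
      moreover have "hd ?Z = (0, 0)" using ne A hd_col[of 0 B 0] B
        by (simp add: upt_conv_Cons del: upt_Suc)
      ultimately show ?thesis using last_hd_cedges[of ?Z] A \<open>c = 0\<close> by simp
    qed
  next
    case False
    then show ?thesis using cedges_diag_cycle[OF ic] by simp
  qed
  show "{(i, c), (i, Suc c mod B)} \<in> cedges (diag_cycle A B) \<union> cedges ?Z"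
    if ic: "i < A" "c < B" for i c
  proof (cases "(i + c) mod B = B - 1")
    case True
    then show ?thesis using cedges_diag_cycle[OF ic] by simp
  next
    case False
    then show ?thesis
      using wedges_col[OF B ic(2) False] wedges_concat(1)[of 0 A "col B" i] ne ic
      by (auto intro!: wedges_cedges)
  qed
qed

end

section \<open>Three cycles in a torus with chords\<close>

text \<open>The cycle is rotated to start right after position \<open>t\<close> and cut right after
  position \<open>s\<close>, so that the two arcs become the joints between \<open>P\<close> and
  \<open>Q\<close>.\<close>

lemma split_at_two_arcs:
  assumes "s < length xs" "t < length xs" "s \<noteq> t"
  obtains P Q where "P \<noteq> []" "Q \<noteq> []" "cedges (P @ Q) = cedges xs"
    "set (P @ Q) = set xs" "length (P @ Q) = length xs"
    "last P = xs ! s" "hd Q = xs ! (Suc s mod length xs)"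
    "last Q = xs ! t" "hd P = xs ! (Suc t mod length xs)"
proof -
  let ?n = "length xs"
  define ys where "ys = rotate (Suc t) xs"
  define k where "k = (s + ?n - Suc t) mod ?n"
  have n: "0 < ?n" using assms by linarith
  have k: "k < ?n" unfolding k_def using n by simp
  have ks: "(Suc t + k) mod ?n = s"
  proof -
    have "Suc t + (s + ?n - Suc t) = s + ?n" using assms(2) by simp
    then show ?thesis using assms(1) unfolding k_def by (simp add: mod_add_right_eq del: add_Suc)
  qed
  \<comment> \<open>Here \<open>s \<noteq> t\<close> enters: otherwise the second piece would be
    empty.\<close>
  have "k \<noteq> ?n - 1"
  proof
    assume "k = ?n - 1"
    then have "Suc t + k = t + ?n" using n by simp
    then have "(t + ?n) mod ?n = s" using ks by (simp only:)
    then show False using assms by simp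
  qed
  with k have k: "Suc k < ?n" by linarith
  have nth: "ys ! i = xs ! ((Suc t + i) mod ?n)" if "i < ?n" for i
    using nth_rotate[OF that] by (simp only: ys_def)
  have len: "length ys = ?n" by (simp add: ys_def)
  show thesis
  proof
    show "take (Suc k) ys \<noteq> []" "drop (Suc k) ys \<noteq> []" using k n len by auto
    show "cedges (take (Suc k) ys @ drop (Suc k) ys) = cedges xs"
      "set (take (Suc k) ys @ drop (Suc k) ys) = set xs"
      "length (take (Suc k) ys @ drop (Suc k) ys) = ?n"
      unfolding append_take_drop_id ys_def by (simp_all only: cedges_rotate set_rotate length_rotate)
    show "last (take (Suc k) ys) = xs ! s"
      using k len ks nth[of k] by (simp add: take_Suc_conv_app_nth)
    show "hd (drop (Suc k) ys) = xs ! (Suc s mod ?n)"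
      using k len nth[of "Suc k"] ks by (simp add: hd_drop_conv_nth) (metis mod_Suc_eq)
    have "Suc t + (?n - 1) = t + ?n" using n by simp
    then have "(Suc t + (?n - 1)) mod ?n = t" using assms(2) by (simp only: mod_add_self2 mod_less)
    then have "ys ! (?n - 1) = xs ! t" using nth[of "?n - 1"] n by (simp only:)
    moreover have "last ys = ys ! (?n - 1)" using n len last_conv_nth[of ys] by fastforce
    ultimately show "last (drop (Suc k) ys) = xs ! t" using k len by (simp add: last_drop)
    have "hd (take (Suc k) ys) = ys ! 0" using n len by (cases ys) auto
    then show "hd (take (Suc k) ys) = xs ! (Suc t mod ?n)" using nth[of 0] n by simp
  qed
qed

text \<open>Let \<open>g\<close> be a second Hamiltonian cycle of the first factor, through the chord from \<open>p\<close> to \<open>0\<close>.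
  The cycle \<open>zigzag_layers\<close> runs through the copies of \<open>g\<close> without that chord, joined by every
  other edge of the columns \<open>0\<close> and \<open>p\<close>. The chords and the rest of these two columns form another
  cycle, the concatenation of the lists \<open>rung_block p c\<close>.\<close>

definition rung_block :: "nat \<Rightarrow> nat \<Rightarrow> (nat \<times> nat) list" where
  "rung_block p c = (if even c then [(0, c), (p, c)] else [(p, c), (0, c)])"

definition zigzag_layers :: "nat \<Rightarrow> nat list \<Rightarrow> (nat \<times> nat) list" where
  "zigzag_layers B g = concat (map (\<lambda>c. map (\<lambda>a. (a, c)) (if even c then rev g else g)) [0..<B])"

context
  fixes A B p :: nat and g :: "nat list"
  assumes B4: "4 \<le> B" and evenB: "even B" and dvd: "B dvd A" and A0: "0 < A"
    and cop: "coprime (B - 1) A"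
    and p: "odd p" "p mod B \<noteq> 1" "Suc p < A"
    and g: "distinct g" "set g = {..<A}" "hd g = 0" "last g = p"
begin

text \<open>The starting point is the diagonal cycle and the cycle of all columns. In columns
  \<open>0\<close> and \<open>p\<close>, \<open>zigzag_layers\<close> takes every other edge and
  gives up the chords in exchange. What remains of the column cycle, with these chords, is two
  cycles \<open>CJ\<close> and \<open>CI\<close>; exchanging arcs with the diagonal cycle joins them
  into one and keeps the diagonal cycle in one piece.\<close>

lemma torus_three_cycles:
  obtains Z1 Z2 Z3 :: "(nat \<times> nat) list" where
    "distinct Z1" "set Z1 = {..<A} \<times> {..<B}" "distinct Z2" "set Z2 = {..<A} \<times> {..<B}"
    "distinct Z3" "set Z3 = {..<A} \<times> {..<B}"
    "\<And>i c. i < A \<Longrightarrow> c < B \<Longrightarrow> {(i, c), (Suc i mod A, c)} \<in> cedges Z1 \<union> cedges Z2 \<union> cedges Z3"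
    "\<And>i c. i < A \<Longrightarrow> c < B \<Longrightarrow> {(i, c), (i, Suc c mod B)} \<in> cedges Z1 \<union> cedges Z2 \<union> cedges Z3"
    "\<And>a b c. {a, b} \<in> cedges g \<Longrightarrow> c < B \<Longrightarrow>
      {(a, c), (b, c)} \<in> cedges Z1 \<union> cedges Z2 \<union> cedges Z3"
proof -
  have B0: "0 < B" "2 \<le> B" using B4 by linarith+
  note diag = set_diag_cycle[OF B0(2) dvd A0 cop] distinct_diag_cycle[OF B0(2) dvd A0 cop]
    length_diag_cycle[OF B0(2) dvd A0 cop]
  have gne: "g \<noteq> []" using g(2) A0 by (metis empty_iff lessThan_iff list.set(1))
  \<comment> \<open>The diagonal cycle uses the edge from height \<open>e\<close> to
    \<open>e + 1\<close> in column \<open>p\<close>, and the one from \<open>B - 1\<close> to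
    \<open>0\<close> in column \<open>0\<close>. These edges are missing from the ladder formed by
    the lists \<open>rung_block p c\<close> and cut it in two.\<close>
  define e where "e = B - 1 - p mod B"
  have pB: "p mod B < B" using B0 by simp
  have "odd (p mod B)" using p(1) evenB by (simp add: dvd_mod_iff)
  then have p3: "3 \<le> p mod B" using p(2) 
    by (metis One_nat_def Suc_leI even_zero even_numeral le_neq_implies_less not_less_eq_eq
        numeral_3_eq_3 numeral_2_eq_2 le_zero_eq not_less)
  \<comment> \<open>The square used for the exchange lies in layers \<open>e + 1\<close> and
    \<open>e + 2\<close>, which must not wrap around; \<open>p mod B = 1\<close> would give
    \<open>e = B - 2\<close>. As \<open>e\<close> is even, the part of the ladder that stops at
    height \<open>e\<close> stops in column \<open>p\<close>.\<close>
  then have e: "e + 4 \<le> B" and evene: "even e"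
    using pB \<open>odd (p mod B)\<close> evenB unfolding e_def by (linarith, simp)
  have p1: "3 \<le> p" using p3 mod_less_eq_dividend[of p B] by linarith
  have pe: "(p + e) mod B = B - 1"
  proof -
    have "p + e = (p div B) * B + (B - 1)"
      using div_mult_mod_eq[of p B] pB unfolding e_def by linarith
    then show ?thesis using B0 by (metis diff_less mod_less mod_mult_self3 zero_less_one)
  qed
  have "odd (B - 1)" using evenB B0 by simp
  define Y where "Y = rung_block p"
  have Yne: "Y c \<noteq> []" for c by (simp add: Y_def rung_block_def)
  have Cne: "col B i \<noteq> []" for i using B0 by simp
  define G where "G = zigzag_layers B g"
  \<comment> \<open>The ladder from \<open>(0, 0)\<close> to \<open>(p, e)\<close> closes up through
    the columns after \<open>p\<close>, which end at \<open>(A - 1, 0)\<close>; the ladder from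
    \<open>(p, e + 1)\<close> to \<open>(0, B - 1)\<close> closes up through the columns before
    \<open>p\<close>, which end at \<open>(p - 1, e + 1)\<close>.\<close>
  define CJ where "CJ = concat (map Y [0..<Suc e]) @ concat (map (col B) [Suc p..<A])"
  define CI where "CI = concat (map Y [Suc e..<B]) @ concat (map (col B) [1..<p])"

  text \<open>The square with corners \<open>(A - 1, e + 1), (0, e + 1), (0, e + 2), (A - 1, e + 2)\<close> has two
    parallel sides on the diagonal cycle, while its other sides lie on \<open>CJ\<close> and \<open>CI\<close>.\<close>

  let ?a = "(A - 1, Suc e)" and ?b = "(0::nat, Suc e)"
  let ?c = "(A - 1, Suc (Suc e))" and ?d = "(0::nat, Suc (Suc e))"
  have m1: "(A - 1 + Suc e) mod B = e"
  proof -
    have "A - 1 + Suc e = A + e" using A0 by simp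
    moreover have "(A + e) mod B = e mod B" using dvd by (metis add_0 dvd_imp_mod_0 mod_add_left_eq)
    ultimately show ?thesis using e by simp
  qed
  then have m2: "(A - 1 + Suc (Suc e)) mod B = Suc e" using e by (simp add: mod_Suc)
  obtain P Q where PQ: "P \<noteq> []" "Q \<noteq> []" "cedges (P @ Q) = cedges (diag_cycle A B)"
    "set (P @ Q) = {..<A} \<times> {..<B}" "length (P @ Q) = A * B"
    "last P = ?a" "hd Q = ?b" "last Q = ?c" "hd P = ?d"
  proof -
    have lt: "A - 1 < A" "Suc e < B" "Suc (Suc e) < B" using A0 e by linarith+
    obtain s where s: "s < A * B" "diag_pos A B s = ?a"
      using diag_cycle_arc[OF B0(2) dvd A0 cop lt(1,2)] .
    obtain t where t: "t < A * B" "diag_pos A B t = ?c"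
      using diag_cycle_arc[OF B0(2) dvd A0 cop lt(1,3)] .
    have st: "s \<noteq> t" using s t by auto
    have nth: "diag_cycle A B ! (Suc i mod (A * B)) = diag_pos A B (Suc i)" if "i < A * B" for i
    proof (cases "Suc i = A * B")
      case True
      then show ?thesis using diag_pos_period[OF B0(2) dvd A0 cop] A0 B0 by (simp add: diag_cycle_def)
    next
      case False
      then have "Suc i < A * B" using that by linarith
      then show ?thesis by (simp add: diag_cycle_def)
    qed
    have "diag_cycle A B ! s = ?a" "diag_cycle A B ! t = ?c"
      using s t by (auto simp: diag_cycle_def)
    moreover have "diag_cycle A B ! (Suc s mod (A * B)) = ?b"
      "diag_cycle A B ! (Suc t mod (A * B)) = ?d"
      using nth s t m1 m2 e A0 diag_pos_Suc[OF B0(2) dvd A0 cop s(2)] diag_pos_Suc[OF B0(2) dvd A0 cop t(2)]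
      by simp_all
    ultimately have eqs: "diag_cycle A B ! s = ?a" "diag_cycle A B ! t = ?c"
      "diag_cycle A B ! (Suc s mod (A * B)) = ?b" "diag_cycle A B ! (Suc t mod (A * B)) = ?d"
      by blast+
    show thesis
      by (rule split_at_two_arcs[of s "diag_cycle A B" t, unfolded diag, OF s(1) t(1) st, unfolded eqs])
        (rule that)
  qed

  define C1 C2 where "C1 = take (Suc e) (col B (A - 1))" and "C2 = drop (Suc e) (col B (A - 1))"
  have "col B (A - 1) ! e = ?a" "col B (A - 1) ! Suc e = ?c"
    using m1 m2 e col_nth[of "Suc e" B "A - 1" e] col_nth[of "Suc (Suc e)" B "A - 1" "Suc e"]
    by simp_all
  then have C: "C1 \<noteq> []" "C2 \<noteq> []" "last C1 = ?a" "hd C2 = ?c" "C1 @ C2 = col B (A - 1)"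
    using e B0 by (simp_all add: C1_def C2_def last_conv_nth hd_drop_conv_nth)
  \<comment> \<open>\<open>R\<close> is \<open>CJ\<close> turned to start at \<open>?c\<close> and
    end at \<open>?a\<close>, opening an edge of column \<open>A - 1\<close>. Likewise
    \<open>S\<close> below is \<open>CI\<close> turned to start at \<open>?d\<close> and end at
    \<open>?b\<close>, opening an edge of column \<open>0\<close>.\<close>
  define R where "R = C2 @ concat (map Y [0..<Suc e]) @ concat (map (col B) [Suc p..<A - 1]) @ C1"
  have "[Suc p..<A] = [Suc p..<A - 1] @ [A - 1]"
    using p(3) upt_Suc_append[of "Suc p" "A - 1"] by simp
  then have CJ': "CJ = (concat (map Y [0..<Suc e]) @ concat (map (col B) [Suc p..<A - 1]) @ C1) @ C2"
    unfolding CJ_def using C(5) by simp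
  have R: "cedges R = cedges CJ" "R \<noteq> []" "last R = ?a" "hd R = ?c"
    using C unfolding CJ' R_def by (simp_all add: cedges_swap[of C2] del: append_assoc)
  define S where "S = (concat (map Y [Suc (Suc e)..<B]) @ concat (map (col B) [1..<p])) @ Y (Suc e)"
  have upt: "[Suc e..<B] = Suc e # [Suc (Suc e)..<B]"
    "[Suc (Suc e)..<B] = Suc (Suc e) # [Suc (Suc (Suc e))..<B]"
    using e by (simp_all add: upt_conv_Cons)
  have CI': "CI = Y (Suc e) @ concat (map Y [Suc (Suc e)..<B]) @ concat (map (col B) [1..<p])"
    unfolding CI_def upt(1) by simp
  have S: "cedges S = cedges CI" unfolding CI' S_def by (rule cedges_swap)
  have S': "S \<noteq> []" "last S = ?b" "hd S = ?d"
    using evene unfolding S_def upt(2) by (simp_all add: Y_def rung_block_def)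

  have ex: "cedges (P @ rev Q) \<union> cedges (R @ rev S) = cedges (diag_cycle A B) \<union> cedges CJ \<union> cedges CI"
    using cedges_exchange[OF PQ(1,2) R(2) S'(1) PQ(6-9) R(3,4) S'(2,3)] PQ(3) R(1) S by simp

  have setY: "set (Y c) = {0, p} \<times> {c}" and lenY: "length (Y c) = 2" for c
    by (auto simp: Y_def rung_block_def)
  define L where "L c = map (\<lambda>a. (a, c)) (if even c then rev g else g)" for c :: nat
  have G: "G = concat (map L [0..<B])" unfolding G_def zigzag_layers_def L_def ..
  have setL: "set (L c) = (\<lambda>a. (a, c)) ` {..<A}" and lenL: "length (L c) = A" for c
    using g(1,2) distinct_card[of g] by (simp_all add: L_def)
  have Lne: "L c \<noteq> []" for c using gne by (simp add: L_def)
  have Lends: "hd (L c) = (if even c then p else 0, c)" "last (L c) = (if even c then 0 else p, c)" for c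
    using gne g(3,4) by (simp_all add: L_def hd_map last_map hd_rev last_rev)
  have setG: "set G = {..<A} \<times> {..<B}"
    unfolding G by (auto simp: setL)
  have "length G = A * B"
    by (simp add: G length_concat comp_def lenL sum_list_triv)
  then have distG: "distinct G"
    by (intro card_distinct) (simp only: setG card_cartesian_product card_lessThan)
  have setPQ: "set (P @ rev Q) = {..<A} \<times> {..<B}" using PQ(4) by simp
  have distPQ: "distinct (P @ rev Q)"
    using PQ(5) by (intro card_distinct) (simp only: setPQ card_cartesian_product card_lessThan, simp)
  have setRS: "set (R @ rev S) = {..<A} \<times> {..<B}"
  proof -
    have "set (R @ rev S) = set CJ \<union> set CI" unfolding CJ' CI' R_def S_def by auto
    also have "set CJ = {0, p} \<times> {..<Suc e} \<union> {Suc p..<A} \<times> {..<B}"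
      unfolding CJ_def by (auto simp: setY set_col[OF B0(1)] simp del: upt_Suc)
    also have "set CI = {0, p} \<times> {Suc e..<B} \<union> {1..<p} \<times> {..<B}"
      unfolding CI_def by (auto simp: setY set_col[OF B0(1)])
    also have "{0, p} \<times> {..<Suc e} \<union> {Suc p..<A} \<times> {..<B} \<union> ({0, p} \<times> {Suc e..<B} \<union> {1..<p} \<times> {..<B})
      = ({0, p} \<union> {1..<p} \<union> {Suc p..<A}) \<times> {..<B}"
    proof -
      have "{..<B} = {..<Suc e} \<union> {Suc e..<B}" using e by auto
      then show ?thesis by blast
    qed
    also have "{0, p} \<union> {1..<p} \<union> {Suc p..<A} = {..<A}" using p p1 by auto
    finally show ?thesis .
  qed
  have "length (R @ rev S) = length CJ + length CI" unfolding CJ' CI' R_def S_def by simp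
  also have "length CJ = 2 * Suc e + (A - Suc p) * B"
    unfolding CJ_def by (simp add: length_concat comp_def lenY sum_list_triv)
  also have "length CI = 2 * (B - Suc e) + (p - 1) * B"
    unfolding CI_def by (simp add: length_concat comp_def lenY sum_list_triv)
  also have "2 * Suc e + (A - Suc p) * B + (2 * (B - Suc e) + (p - 1) * B) =
      2 * (Suc e + (B - Suc e)) + ((A - Suc p) + (p - 1)) * B"
    by (simp only: add_mult_distrib add_mult_distrib2 ac_simps)
  also have "Suc e + (B - Suc e) = B" using e by simp
  also have "(A - Suc p) + (p - 1) = A - 2" using p p1 by linarith
  also have "2 * B + (A - 2) * B = (2 + (A - 2)) * B" by (simp only: add_mult_distrib)
  also have "2 + (A - 2) = A" using p p1 by linarith
  finally have distRS: "distinct (R @ rev S)"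
    by (intro card_distinct) (simp only: setRS card_cartesian_product card_lessThan)

  let ?U = "cedges G \<union> cedges (P @ rev Q) \<union> cedges (R @ rev S)"
  have U: "?U = cedges G \<union> cedges (diag_cycle A B) \<union> cedges CJ \<union> cedges CI"
    using ex by blast
  have diagU: "(i + c) mod B \<noteq> B - 1 \<Longrightarrow> {(i, c), (Suc i mod A, c)} \<in> ?U"
    "(i + c) mod B = B - 1 \<Longrightarrow> {(i, c), (i, Suc c mod B)} \<in> ?U" if "i < A" "c < B" for i c
    using cedges_diag_cycle[OF B0(2) dvd A0 cop that] unfolding U by auto
  have wJ: "w \<in> wedges CJ \<Longrightarrow> w \<in> ?U" and wI: "w \<in> wedges CI \<Longrightarrow> w \<in> ?U" for w
    unfolding U by (auto dest: wedges_cedges)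
  have wG: "w \<in> cedges G \<Longrightarrow> w \<in> ?U" for w by simp
  have wJ': "w \<in> wedges (concat (map Y [0..<Suc e])) \<or> w \<in> wedges (concat (map (col B) [Suc p..<A])) \<Longrightarrow> w \<in> ?U" for w
    using wJ wedges_append_subset unfolding CJ_def by blast
  have wI': "w \<in> wedges (concat (map Y [Suc e..<B])) \<or> w \<in> wedges (concat (map (col B) [1..<p])) \<Longrightarrow> w \<in> ?U" for w
    using wI wedges_append_subset unfolding CI_def by blast
  have colU: "w \<in> wedges (col B i) \<Longrightarrow> w \<in> ?U" if "i < A" "i \<noteq> 0" "i \<noteq> p" for w i
  proof -
    assume w: "w \<in> wedges (col B i)"
    show "w \<in> ?U"
    proof (cases "i < p")
      case True then show ?thesis
        using wedges_concat(1)[of 1 p "col B" i] Cne w that by (intro wI') auto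
    next
      case False then show ?thesis
        using wedges_concat(1)[of "Suc p" A "col B" i] Cne w that by (intro wJ') auto
    qed
  qed
  have YU: "w \<in> wedges (Y c) \<Longrightarrow> w \<in> ?U" if "c < B" for w c
  proof -
    assume w: "w \<in> wedges (Y c)"
    show "w \<in> ?U"
    proof (cases "c \<le> e")
      case True then show ?thesis
        using wedges_concat(1)[of 0 "Suc e" Y c] Yne w that by (intro wJ') auto
    next
      case False then show ?thesis
        using wedges_concat(1)[of "Suc e" B Y c] Yne w that by (intro wI') auto
    qed
  qed
  have YYU: "{last (Y c), hd (Y (Suc c))} \<in> ?U" if "Suc c < B" "c \<noteq> e" for c
  proof (cases "c < e")
    case True then show ?thesis
      using wedges_concat(2)[of 0 "Suc e" Y c] Yne that by (intro wJ') auto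
  next
    case False then show ?thesis
      using wedges_concat(2)[of "Suc e" B Y c] Yne that by (intro wI') auto
  qed

  have layers: "w \<in> wedges (map (\<lambda>a. (a, c)) g) \<Longrightarrow> w \<in> ?U" if "c < B" for w c
  proof (rule wG, rule wedges_cedges)
    assume "w \<in> wedges (map (\<lambda>a. (a, c)) g)"
    then have "w \<in> wedges (L c)" by (simp add: L_def flip: rev_map)
    then show "w \<in> wedges G" unfolding G using wedges_concat(1)[of 0 B L c] Lne that by auto
  qed
  have rungs: "{(if even c then 0 else p, c), (if even c then 0 else p, Suc c mod B)} \<in> ?U"
    if "c < B" for c
  proof (cases "Suc c < B")
    case True
    then have "{last (L c), hd (L (Suc c))} \<in> wedges G"
      unfolding G using Lne by (intro wedges_concat(2)) auto
    then show ?thesis using True by (intro wG wedges_cedges) (simp add: Lends split: if_splits)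
  next
    case False
    with that have c: "B = Suc c" by linarith
    have "last G = last (L c)" unfolding G c using Lne by simp
    moreover have "hd G = hd (L 0)"
      unfolding G using Lne B0 by (simp add: upt_conv_Cons del: upt_Suc)
    ultimately show ?thesis
      using last_hd_cedges[of G] c \<open>odd (B - 1)\<close> by (intro wG) (simp add: Lends)
  qed

  show thesis
  proof (rule that[OF distG setG distPQ setPQ distRS setRS])
    fix i c assume ic: "i < A" "c < B"
    show "{(i, c), (Suc i mod A, c)} \<in> ?U"
    proof (cases "(i + c) mod B = B - 1")
      case False then show ?thesis using diagU ic by blast
    next
      case True
      have 0: "(Suc i + c) mod B = 0" using mod_eq_pred_iff[OF B0(1), of "i + c"] True by simp
      have last: "last (col B i) = (i, c)" using last_col[OF ic(2) True] .
      have hd: "hd (col B (Suc i)) = (Suc i, c)" using hd_col[OF ic(2) 0] .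
      have ce: "c = e" if "i = p"
        using add_left_mod_cancel[of p c B e] True pe that ic e by simp
      \<comment> \<open>The first four cases are the joints between ladder and columns; in the
        fifth, two full columns meet.\<close>
      consider "i = 0" | "Suc i = p" | "i = p" | "Suc i = A" | "0 < i" "Suc i \<noteq> p" "i \<noteq> p" "Suc i < A"
        using ic by linarith
      then show ?thesis
      proof cases
        case 1
        then have c: "c = B - 1" using True ic by simp
        have "last (concat (map Y [Suc e..<B])) = (0, c)"
          using c e \<open>odd (B - 1)\<close> by (cases B) (auto simp: Y_def rung_block_def)
        moreover have "hd (concat (map (col B) [1..<p])) = (1, c)"
          using p1 Cne hd 1 by (simp add: upt_conv_Cons)
        moreover have "concat (map Y [Suc e..<B]) \<noteq> []" using upt Yne by simp
        moreover have "concat (map (col B) [1..<p]) \<noteq> []" using p1 Cne by (simp add: upt_conv_Cons)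
        ultimately have "{(0, c), (1, c)} \<in> wedges CI" unfolding CI_def by (simp add: wedges_append)
        then show ?thesis using wI 1 p by simp
      next
        case 2
        have "last CI = (i, c)"
          using p1 2 last Cne unfolding CI_def by (cases p) auto
        moreover have "c = Suc e"
        proof -
          have "(p + c) mod B = 0" using 0 2 by simp
          moreover have "(p + Suc e) mod B = 0" using pe mod_eq_pred_iff[OF B0(1), of "p + e"] by simp
          ultimately show ?thesis using add_left_mod_cancel[of p c B "Suc e"] ic e by simp
        qed
        moreover have "hd CI = (p, Suc e)"
          unfolding CI_def upt(1) using evene by (simp add: Y_def rung_block_def)
        ultimately show ?thesis using last_hd_cedges[of CI] 2 p U by auto
      next
        case 3
        have "last (concat (map Y [0..<Suc e])) = (p, e)"
          using evene by (simp add: Y_def rung_block_def)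
        moreover have "hd (concat (map (col B) [Suc p..<A])) = (Suc p, e)"
          using p Cne hd 3 ce by (simp add: upt_conv_Cons)
        moreover have "concat (map Y [0..<Suc e]) \<noteq> []" using Yne by simp
        moreover have "concat (map (col B) [Suc p..<A]) \<noteq> []" using p Cne by (simp add: upt_conv_Cons)
        ultimately have "{(p, e), (Suc p, e)} \<in> wedges CJ"
          unfolding CJ_def by (simp add: wedges_append del: upt_Suc)
        then show ?thesis using wJ 3 p ce by simp
      next
        case 4
        then have A: "A = Suc i" by simp
        have "c mod B = 0"
          using 0 dvd A by (metis add_0 dvd_imp_mod_0 mod_add_left_eq)
        then have "c = 0" using ic by simp
        moreover have "last CJ = (i, c)" using A p last Cne unfolding CJ_def by auto
        moreover have "hd CJ = (0, 0)"
          unfolding CJ_def by (simp add: upt_conv_Cons Y_def rung_block_def del: upt_Suc)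
        ultimately show ?thesis using last_hd_cedges[of CJ] A U by auto
      next
        case 5
        show ?thesis
        proof (cases "i < p")
          case True then show ?thesis
            using wedges_concat(2)[of 1 p "col B" i] Cne 5 last hd by (intro wI') auto
        next
          case False then show ?thesis
            using wedges_concat(2)[of "Suc p" A "col B" i] Cne 5 last hd by (intro wJ') auto
        qed
      qed
    qed
  next
    fix i c assume ic: "i < A" "c < B"
    show "{(i, c), (i, Suc c mod B)} \<in> ?U"
    proof (cases "(i + c) mod B = B - 1")
      case True then show ?thesis using diagU ic by blast
    next
      case False
      \<comment> \<open>In columns \<open>0\<close> and \<open>p\<close>, the first two cases are
        the edges taken by \<open>zigzag_layers\<close>, the next two those left to the
        ladder.\<close>
      consider "i = 0" "even c" | "i = p" "odd c" | "i = 0" "odd c" | "i = p" "even c"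
        | "i \<noteq> 0" "i \<noteq> p" by blast
      then show ?thesis
      proof cases
        case 1 then show ?thesis using rungs[OF ic(2)] by simp
      next
        case 2 then show ?thesis using rungs[OF ic(2)] by simp
      next
        case 3
        then have "Suc c < B" using False ic by (cases "Suc c = B") auto
        moreover have "c \<noteq> e" using 3 evene by auto
        ultimately show ?thesis using YYU[of c] 3 by (simp add: Y_def rung_block_def)
      next
        case 4
        then have "Suc c < B" using ic evenB by (metis Suc_lessI even_Suc)
        moreover have "c \<noteq> e" using False pe 4 by auto
        ultimately show ?thesis using YYU[of c] 4 by (simp add: Y_def rung_block_def)
      next
        case 5 then show ?thesis using colU[OF ic(1)] wedges_col[OF B0(1) ic(2) False] by blast
      qed
    qed
  next
    fix a b c assume ab: "{a, b} \<in> cedges g" and c: "c < B"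
    then consider "{a, b} = {p, 0}" | "{a, b} \<in> wedges g" using g by (auto simp: cedges_def)
    then show "{(a, c), (b, c)} \<in> ?U"
    proof cases
      case 1
      then have "{(a, c), (b, c)} \<in> wedges (Y c)"
        by (auto simp: Y_def rung_block_def doubleton_eq_iff)
      then show ?thesis using YU[OF c] by blast
    next
      case 2
      have "{(a, c), (b, c)} = (\<lambda>a. (a, c)) ` {a, b}" by simp
      then have "{(a, c), (b, c)} \<in> wedges (map (\<lambda>a. (a, c)) g)"
        using 2 unfolding wedges_map by blast
      then show ?thesis using layers[OF c] by blast
    qed
  qed
qed

end

section \<open>Hamiltonian decomposition of even cubes\<close>

text \<open>The size of \<open>E\<close> is at most that of the union, which is at most the sum of
  the sizes, which is at most \<open>card I * N\<close>. Equality of the ends forces equality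
  throughout: nothing outside \<open>E\<close> is covered and nothing is covered twice.\<close>

lemma cover_imp_partition:
  assumes fin: "finite I" "\<And>i. i \<in> I \<Longrightarrow> finite (S i)"
    and le: "\<And>i. i \<in> I \<Longrightarrow> card (S i) \<le> N"
    and cover: "E \<subseteq> (\<Union>i\<in>I. S i)" and card: "card E = card I * N"
  shows "(\<Union>i\<in>I. S i) = E"
    and "i \<in> I \<Longrightarrow> j \<in> I \<Longrightarrow> i \<noteq> j \<Longrightarrow> S i \<inter> S j = {}"
proof -
  have finU: "finite (\<Union>i\<in>I. S i)" using fin by blast
  have sum: "(\<Sum>i\<in>I. card (S i)) \<le> card E"
    using sum_bounded_above[of I "\<lambda>i. card (S i)" N] le card by simp
  moreover have U: "card (\<Union>i\<in>I. S i) \<le> (\<Sum>i\<in>I. card (S i))" using fin by (intro card_UN_le)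
  ultimately show E: "(\<Union>i\<in>I. S i) = E"
    using card_seteq[OF finU cover] by simp
  show "S i \<inter> S j = {}" if "i \<in> I" "j \<in> I" "i \<noteq> j"
  proof (rule ccontr)
    assume "S i \<inter> S j \<noteq> {}"
    then obtain x where x: "x \<in> S i" "x \<in> S j" by blast
    \<comment> \<open>Dropping a doubly covered element from one of its sets keeps the union but
      lowers the sum.\<close>
    define T where "T = S(i := S i - {x})"
    have "(\<Union>l\<in>I. T l) = (\<Union>l\<in>I. S l)"
    proof (intro equalityI subsetI)
      fix y assume "y \<in> (\<Union>l\<in>I. S l)"
      then obtain l where l: "l \<in> I" "y \<in> S l" by blast
      then show "y \<in> (\<Union>l\<in>I. T l)"
        using that x by (cases "l = i \<and> y = x") (auto simp: T_def intro: bexI[of _ j] bexI[of _ l])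
    qed (auto simp: T_def split: if_splits)
    then have "card (\<Union>i\<in>I. S i) \<le> (\<Sum>l\<in>I. card (T l))"
      using card_UN_le[OF fin(1), of T] by simp
    also have "\<dots> < (\<Sum>l\<in>I. card (S l))"
    proof (rule sum_strict_mono_ex1[OF fin(1)])
      show "\<forall>l\<in>I. card (T l) \<le> card (S l)"
        using fin(2) by (auto simp: T_def intro: card_mono)
      show "\<exists>l\<in>I. card (T l) < card (S l)"
      proof
        show "card (T i) < card (S i)"
          using card_Diff1_less[OF fin(2)[OF that(1)] x(1)] by (simp only: T_def fun_upd_same)
      qed fact
    qed
    finally show False using sum E by simp
  qed
qed

lemma edge_hypercube_appendE:
  assumes "e \<in> edges (hypercube (k + m))"
  obtains (left) a a' b where "e = {a @ b, a' @ b}" "{a, a'} \<in> edges (hypercube k)" "length b = m"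
  | (right) a b b' where "e = {a @ b, a @ b'}" "length a = k" "{b, b'} \<in> edges (hypercube m)"
proof -
  obtain i x where x: "e = {x, x[i := True]}" "i < k + m" "length x = k + m" "\<not> x ! i"
    using assms unfolding edges_hypercube_flip by auto
  define a b where "a = take k x" and "b = drop k x"
  have ab: "x = a @ b" "length a = k" "length b = m" using x by (simp_all add: a_def b_def)
  show thesis
  proof (cases "i < k")
    case True
    then have "{a, a[i := True]} \<in> edges (hypercube k)"
      unfolding edges_hypercube_flip using x ab by (force simp: nth_append)
    then show ?thesis using left[of a b "a[i := True]"] x ab True by (simp add: list_update_append1)
  next
    case False
    then have "{b, b[i - k := True]} \<in> edges (hypercube m)"
      unfolding edges_hypercube_flip using x ab by (force simp: nth_append)
    then show ?thesis using right[of a b "b[i - k := True]"] x ab False by (simp add: list_update_append)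
  qed
qed

text \<open>Bipartiteness of the cube, by the parity of the number of \<open>True\<close> entries.
  It makes the position of a chord on a cycle odd.\<close>

lemma edge_hypercube_parity:
  assumes "{x, y} \<in> edges (hypercube n)"
  shows "even (length (filter id x)) \<noteq> even (length (filter id y))"
proof -
  obtain i z where z: "{x, y} = {z, z[i := True]}" "i < n" "length z = n" "\<not> z ! i"
    using assms unfolding edges_hypercube_flip by auto
  have "filter id z = filter id (take i z) @ filter id (drop (Suc i) z)"
    using z by (subst id_take_nth_drop[of i z]) simp_all
  moreover have "filter id (z[i := True]) = filter id (take i z) @ True # filter id (drop (Suc i) z)"
    using z by (simp add: upd_conv_take_nth_drop)
  ultimately have "even (length (filter id z)) \<noteq> even (length (filter id (z[i := True])))" by simp
  then show ?thesis using z(1) by (auto simp: doubleton_eq_iff)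
qed

text \<open>Consecutive vertices of the list are not required to be adjacent: in a decomposition this
  follows by counting, once the cycles cover all edges.\<close>

definition ham :: "nat \<Rightarrow> bool list list \<Rightarrow> bool" where
  "ham n xs \<longleftrightarrow> distinct xs \<and> set xs = {x. length x = n}"

definition ham_decomposition :: "nat \<Rightarrow> bool list list list \<Rightarrow> bool" where
  "ham_decomposition n L \<longleftrightarrow> length L = n div 2 \<and> (\<forall>xs\<in>set L. ham n xs) \<and>
     edges (hypercube n) \<subseteq> (\<Union>xs\<in>set L. cedges xs)"

lemma ham_length: "ham n xs \<Longrightarrow> length xs = 2 ^ n"
  using card_verts_hypercube[of n] distinct_card[of xs] by (simp add: ham_def hypercube_def)

lemma ham_nonempty: "ham n xs \<Longrightarrow> xs \<noteq> []"
  using ham_length[of n xs] by auto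

text \<open>The \<open>n div 2\<close> lists have at most \<open>2 ^ n\<close> cyclic edges each,
  and the cube has \<open>n div 2 * 2 ^ n\<close> edges. So they are genuine, edge-disjoint cycles
  of the cube, as the choice of a chord for three cycles requires.\<close>

lemma ham_decomposition_partition:
  assumes "ham_decomposition n L" "even n" "i < n div 2"
  shows "cedges (L ! i) \<subseteq> edges (hypercube n)"
    and "j < n div 2 \<Longrightarrow> i \<noteq> j \<Longrightarrow> cedges (L ! i) \<inter> cedges (L ! j) = {}"
proof -
  have L: "length L = n div 2" "\<And>i. i < n div 2 \<Longrightarrow> ham n (L ! i)"
    "edges (hypercube n) \<subseteq> (\<Union>i<n div 2. cedges (L ! i))"
    using assms(1) by (force simp: ham_decomposition_def in_set_conv_nth)+
  have le: "card (cedges (L ! i)) \<le> 2 ^ n" if "i < n div 2" for i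
    using card_cedges_le[of "L ! i"] ham_length ham_nonempty L(2)[OF that] by metis
  obtain k where k: "n = 2 * k" using assms(2) by blast
  then have card: "card (edges (hypercube n)) = card {..<n div 2} * 2 ^ n"
    using assms(3) by (cases k) (simp_all add: card_edges_hypercube)
  note * = cover_imp_partition[of "{..<n div 2}" "\<lambda>i. cedges (L ! i)" "2 ^ n" "edges (hypercube n)",
      OF _ _ _ L(3) card]
  show "cedges (L ! i) \<subseteq> edges (hypercube n)" using *(1) le assms(3) by auto
  show "j < n div 2 \<Longrightarrow> i \<noteq> j \<Longrightarrow> cedges (L ! i) \<inter> cedges (L ! j) = {}"
    using *(2)[of i j] le assms(3) by simp
qed

text \<open>An edge of a product lies in a copy of a factor, hence in a copy of a cycle from the
  decomposition of that factor. It suffices to record, torus by torus, whose copies the new cycles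
  absorb.\<close>

definition covers_left :: "nat \<Rightarrow> bool list list \<Rightarrow> bool list set set \<Rightarrow> bool" where
  "covers_left m X U \<longleftrightarrow>
     (\<forall>a a' b. {a, a'} \<in> cedges X \<longrightarrow> length b = m \<longrightarrow> {a @ b, a' @ b} \<in> U)"

definition covers_right :: "nat \<Rightarrow> bool list list \<Rightarrow> bool list set set \<Rightarrow> bool" where
  "covers_right k Y U \<longleftrightarrow>
     (\<forall>a b b'. {b, b'} \<in> cedges Y \<longrightarrow> length a = k \<longrightarrow> {a @ b, a @ b'} \<in> U)"

section \<open>From tori to products of Hamiltonian cycles\<close>

locale ham_product =
  fixes k m :: nat and X Y :: "bool list list"
  assumes X: "ham k X" and Y: "ham m Y" and m1: "1 \<le> m" and mk: "m \<le> k"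
begin

definition coord :: "nat \<times> nat \<Rightarrow> bool list" where
  "coord = (\<lambda>(i, c). X ! i @ Y ! c)"

lemma lens: "length X = 2 ^ k" "length Y = 2 ^ m"
  using ham_length X Y by auto

lemma len_nth: "i < 2 ^ k \<Longrightarrow> length (X ! i) = k" "c < 2 ^ m \<Longrightarrow> length (Y ! c) = m"
proof -
  show "length (X ! i) = k" if "i < 2 ^ k"
    using nth_mem[of i X] that lens X unfolding ham_def by auto
  show "length (Y ! c) = m" if "c < 2 ^ m"
    using nth_mem[of c Y] that lens Y unfolding ham_def by auto
qed

lemma ham_coord:
  assumes "distinct Z" "set Z = {..<2 ^ k} \<times> {..<2 ^ m}"
  shows "ham (k + m) (map coord Z)"
  unfolding ham_def
proof
  have "inj_on coord ({..<2 ^ k} \<times> {..<2 ^ m})"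
  proof (rule inj_onI, clarsimp)
    fix i c i' c' assume *: "i < 2 ^ k" "c < 2 ^ m" "i' < 2 ^ k" "c' < 2 ^ m"
      and eq: "coord (i, c) = coord (i', c')"
    then have "X ! i = X ! i'" "Y ! c = Y ! c'" by (auto simp: coord_def len_nth)
    then show "i = i' \<and> c = c'"
      using * X Y lens by (metis ham_def nth_eq_iff_index_eq)
  qed
  then show "distinct (map coord Z)" using assms by (simp add: distinct_map)
  show "set (map coord Z) = {x. length x = k + m}"
  proof (intro equalityI subsetI)
    fix x :: "bool list" assume "x \<in> {x. length x = k + m}"
    then have "take k x \<in> set X" "drop k x \<in> set Y" using X Y by (simp_all add: ham_def)
    then obtain i c where "i < 2 ^ k" "X ! i = take k x" "c < 2 ^ m" "Y ! c = drop k x"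
      by (metis in_set_conv_nth lens)
    then have "x = coord (i, c)" "(i, c) \<in> set Z" by (simp_all add: coord_def assms)
    then show "x \<in> set (map coord Z)" by simp
  qed (auto simp: assms coord_def len_nth)
qed

lemma coord_edge: "{p, q} \<in> cedges Z \<Longrightarrow> set Z \<noteq> {} \<Longrightarrow> {coord p, coord q} \<in> cedges (map coord Z)"
  by (auto simp: cedges_map image_iff intro!: bexI[of _ "{p, q}"])

lemma covers_leftI:
  assumes "\<And>i c. i < 2 ^ k \<Longrightarrow> c < 2 ^ m \<Longrightarrow> {coord (i, c), coord (Suc i mod 2 ^ k, c)} \<in> U"
  shows "covers_left m X U"
  unfolding covers_left_def
proof (intro allI impI)
  fix a a' and b :: "bool list" assume *: "{a, a'} \<in> cedges X" "length b = m"
  obtain i where i: "i < 2 ^ k" "{a, a'} = {X ! i, X ! (Suc i mod 2 ^ k)}"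
    using *(1) ham_nonempty[OF X] lens by (auto simp: cedges_conv_nth)
  have "b \<in> set Y" using *(2) Y by (simp add: ham_def)
  then obtain c where c: "c < 2 ^ m" "b = Y ! c" by (metis in_set_conv_nth lens(2))
  have "{a @ b, a' @ b} = (\<lambda>a. a @ b) ` {a, a'}" by simp
  also have "\<dots> = {coord (i, c), coord (Suc i mod 2 ^ k, c)}" by (simp add: i c coord_def)
  finally show "{a @ b, a' @ b} \<in> U" using assms[OF i(1) c(1)] by simp
qed

lemma covers_rightI:
  assumes "\<And>i c. i < 2 ^ k \<Longrightarrow> c < 2 ^ m \<Longrightarrow> {coord (i, c), coord (i, Suc c mod 2 ^ m)} \<in> U"
  shows "covers_right k Y U"
  unfolding covers_right_def
proof (intro allI impI)
  fix a :: "bool list" and b b' assume *: "{b, b'} \<in> cedges Y" "length a = k"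
  obtain c where c: "c < 2 ^ m" "{b, b'} = {Y ! c, Y ! (Suc c mod 2 ^ m)}"
    using *(1) ham_nonempty[OF Y] lens by (auto simp: cedges_conv_nth)
  have "a \<in> set X" using *(2) X by (simp add: ham_def)
  then obtain i where i: "i < 2 ^ k" "a = X ! i" by (metis in_set_conv_nth lens(1))
  have "{a @ b, a @ b'} = (\<lambda>b. a @ b) ` {b, b'}" by simp
  also have "\<dots> = {coord (i, c), coord (i, Suc c mod 2 ^ m)}" by (simp add: i c coord_def)
  finally show "{a @ b, a @ b'} \<in> U" using assms[OF i(1) c(1)] by simp
qed

lemma torus_conditions:
  "2 \<le> (2::nat) ^ m" "(2::nat) ^ m dvd 2 ^ k" "0 < (2::nat) ^ k" "coprime ((2::nat) ^ m - 1) (2 ^ k)"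
proof -
  show "2 \<le> (2::nat) ^ m" using m1 power_increasing[of 1 m "2::nat"] by simp
  show "(2::nat) ^ m dvd 2 ^ k" using mk by (rule le_imp_power_dvd)
  have "odd ((2::nat) ^ m - 1)" using m1 by simp
  then show "coprime ((2::nat) ^ m - 1) (2 ^ k)" by (simp add: coprime_right_2_iff_odd)
qed simp

lemma two_cycles:
  obtains Z1 Z2 where "ham (k + m) Z1" "ham (k + m) Z2"
    "covers_left m X (cedges Z1 \<union> cedges Z2)" "covers_right k Y (cedges Z1 \<union> cedges Z2)"
proof (rule torus_two_cycles[OF torus_conditions])
  fix Z1 Z2 :: "(nat \<times> nat) list"
  assume Z: "distinct Z1" "set Z1 = {..<2 ^ k} \<times> {..<2 ^ m}"
    "distinct Z2" "set Z2 = {..<2 ^ k} \<times> {..<2 ^ m}"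
    and h: "\<And>i c. i < 2 ^ k \<Longrightarrow> c < 2 ^ m \<Longrightarrow> {(i, c), (Suc i mod 2 ^ k, c)} \<in> cedges Z1 \<union> cedges Z2"
    and v: "\<And>i c. i < 2 ^ k \<Longrightarrow> c < 2 ^ m \<Longrightarrow> {(i, c), (i, Suc c mod 2 ^ m)} \<in> cedges Z1 \<union> cedges Z2"
  let ?U = "cedges (map coord Z1) \<union> cedges (map coord Z2)"
  have ne: "set Z1 \<noteq> {}" "set Z2 \<noteq> {}" unfolding Z by (auto simp: lessThan_empty_iff)
  have U: "{coord p, coord q} \<in> ?U" if "{p, q} \<in> cedges Z1 \<union> cedges Z2" for p q
    using that coord_edge ne by blast
  show thesis
  proof (rule that)
    show "ham (k + m) (map coord Z1)" "ham (k + m) (map coord Z2)"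
      using Z by (auto intro!: ham_coord)
    show "covers_left m X ?U" using h U by (intro covers_leftI) blast
    show "covers_right k Y ?U" using v U by (intro covers_rightI) blast
  qed
qed

end

text \<open>Reading the cycle backwards from the same start sends position \<open>i\<close> to
  \<open>length X - i\<close>. This freedom is used twice: to avoid a bad residue of the chord
  position, and to delay the return of a detour.\<close>

lemma ham_reflect:
  assumes "ham k X" "i < length X"
  obtains X' where "ham k X'" "cedges X' = cedges X" "X' ! 0 = X ! 0"
    "0 < i \<Longrightarrow> X' ! (length X - i) = X ! i"
proof -
  obtain x xs where X: "X = x # xs" using assms by (cases X) auto
  show thesis
  proof (rule that[of "x # rev xs"])
    show "ham k (x # rev xs)" using assms X by (simp add: ham_def)
    have "cedges (x # rev xs) = cedges (rev xs @ [x])" using cedges_swap[of "[x]"] by simp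
    also have "\<dots> = cedges (rev X)" using X by simp
    finally show "cedges (x # rev xs) = cedges X" by simp
    show "(x # rev xs) ! (length X - i) = X ! i" if "0 < i"
      using that assms X by (cases i) (auto simp: nth_Cons' rev_nth)
  qed (simp add: X)
qed

lemma ham_rotate_to_hd:
  assumes "ham k X" "length u = k"
  obtains X' where "ham k X'" "cedges X' = cedges X" "hd X' = u"
proof -
  have "u \<in> set X" using assms by (simp add: ham_def)
  then obtain j where "hd (rotate j X) = u" using rotate_to_hd[OF \<open>u \<in> set X\<close>] by blast
  then show thesis using assms that[of "rotate j X"] by (simp add: ham_def)
qed

lemma cycle_position_parity:
  assumes "cedges X \<subseteq> edges (hypercube k)" "i < length X"
  shows "even (length (filter id (X ! i))) \<longleftrightarrow> even (length (filter id (X ! 0))) = even i"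
  using assms(2)
proof (induction i)
  case (Suc i)
  have "{X ! i, X ! Suc i} \<in> edges (hypercube k)"
    using assms(1) Suc.prems wedges_nth[of i X] wedges_cedges by blast
  from edge_hypercube_parity[OF this] Suc.IH Suc.prems show ?case
    by (simp only: even_Suc Suc_lessD) blast
qed simp

text \<open>Bipartiteness makes the position of \<open>v\<close> odd, and as \<open>{u, v}\<close>
  is not an edge of \<open>X\<close> it is neither \<open>1\<close> nor \<open>2 ^ k - 1\<close>. If
  it is 1 modulo \<open>B\<close>, the reversed cycle has it at -1, which differs from 1 because
  \<open>B \<ge> 4\<close>.\<close>

lemma ham_chord_position:
  assumes X: "ham k X" and E: "cedges X \<subseteq> edges (hypercube k)"
    and uv: "{u, v} \<in> edges (hypercube k)" "{u, v} \<notin> cedges X"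
    and B: "4 \<le> B" "B dvd 2 ^ k"
  obtains X' p where "ham k X'" "cedges X' = cedges X" "X' ! 0 = u" "X' ! p = v"
    "odd p" "p mod B \<noteq> 1" "Suc p < 2 ^ k"
proof -
  have len: "length u = k" "length v = k" using uv(1) unfolding edges_hypercube_flip
    by (auto simp: doubleton_eq_iff)
  obtain X1 where X1: "ham k X1" "cedges X1 = cedges X" "hd X1 = u"
    using ham_rotate_to_hd[OF X len(1)] .
  have lenX1: "length X1 = 2 ^ k" using ham_length X1(1) .
  have "v \<in> set X1" using X1 len by (simp add: ham_def)
  then obtain p where p: "p < 2 ^ k" "X1 ! p = v" by (metis in_set_conv_nth lenX1)
  have 0: "X1 ! 0 = u" using X1 ham_nonempty by (metis hd_conv_nth)
  have props: "odd q \<and> q \<noteq> 1 \<and> Suc q < 2 ^ k"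
    if "ham k Z" "cedges Z = cedges X" "Z ! 0 = u" "Z ! q = v" "q < 2 ^ k" for Z q
  proof -
    have lenZ: "length Z = 2 ^ k" using ham_length that(1) .
    have "even (length (filter id u)) \<noteq> even (length (filter id v))"
      using edge_hypercube_parity uv(1) .
    then have odd: "odd q" using cycle_position_parity[of Z k q] that E lenZ by auto
    have "q \<noteq> 1"
    proof
      assume "q = 1"
      then have "1 < length Z" using that(5) lenZ by (simp only:)
      then have "Suc 0 mod length Z = q" "0 < length Z" using \<open>q = 1\<close> by auto
      then show False using cedges_nth[of 0 Z] that uv(2) by simp
    qed
    moreover have "Suc q \<noteq> 2 ^ k"
    proof
      assume "Suc q = 2 ^ k"
      then have "Suc q mod length Z = 0" "q < length Z" using that(5) lenZ by simp_all
      then show False using cedges_nth[of q Z] that uv(2) by (simp add: insert_commute)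
    qed
    ultimately show ?thesis using odd that(5) by linarith
  qed
  note pp = props[OF X1(1,2) 0 p(2) p(1)]
  show thesis
  proof (cases "p mod B = 1")
    case False
    then show ?thesis using that[OF X1(1,2) 0 p(2)] pp by blast
  next
    case True
    obtain X2 where X2: "ham k X2" "cedges X2 = cedges X1" "X2 ! 0 = X1 ! 0"
      "0 < p \<Longrightarrow> X2 ! (length X1 - p) = X1 ! p"
      using ham_reflect[OF X1(1), of p] p(1) lenX1 by auto
    have p0: "0 < p" using pp by (cases p) auto
    have "(p + (2 ^ k - p)) mod B = 0" using p(1) B(2) by simp
    then have "(p mod B + (2 ^ k - p) mod B) mod B = 0" by (simp only: mod_add_eq)
    then have r: "(1 + (2 ^ k - p) mod B) mod B = 0" by (simp only: True)
    have "(2 ^ k - p) mod B \<noteq> 1"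
    proof
      assume "(2 ^ k - p) mod B = 1"
      with r have "(1 + 1) mod B = 0" by (simp only:)
      then show False using B(1) by simp
    qed
    then show ?thesis
      using that[OF X2(1), of "2 ^ k - p"] props[OF X2(1), of "2 ^ k - p"] X1 X2 0 p p0 lenX1 by auto
  qed
qed

lemma three_cycles:
  assumes X: "ham k X1" "cedges X1 \<subseteq> edges (hypercube k)"
    and X2: "ham k X2" "cedges X2 \<subseteq> edges (hypercube k)" "cedges X1 \<inter> cedges X2 = {}"
    and Y: "ham m Y" and m: "2 \<le> m" "m \<le> k"
  obtains Z1 Z2 Z3 where "ham (k + m) Z1" "ham (k + m) Z2" "ham (k + m) Z3"
    "covers_left m X1 (cedges Z1 \<union> cedges Z2 \<union> cedges Z3)"
    "covers_left m X2 (cedges Z1 \<union> cedges Z2 \<union> cedges Z3)"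
    "covers_right k Y (cedges Z1 \<union> cedges Z2 \<union> cedges Z3)"
proof -
  have B4: "4 \<le> (2::nat) ^ m" using power_increasing[OF m(1), of "2::nat"] by simp
  \<comment> \<open>The chord is the closing edge of \<open>X2\<close>; edge-disjointness keeps it
    off \<open>X1\<close>.\<close>
  have "{hd X2, last X2} \<in> cedges X2" using last_hd_cedges[of X2] by (simp add: insert_commute)
  then have "{hd X2, last X2} \<in> edges (hypercube k)" "{hd X2, last X2} \<notin> cedges X1"
    using X2 by blast+
  from ham_chord_position[OF X this B4 le_imp_power_dvd[OF m(2)]]
  obtain X p where X': "ham k X" "cedges X = cedges X1" "X ! 0 = hd X2" "X ! p = last X2"
    and p: "odd p" "p mod 2 ^ m \<noteq> 1" "Suc p < 2 ^ k" by metis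
  interpret ham_product k m X Y using X' Y m by unfold_locales auto
  \<comment> \<open>\<open>pos\<close> rewrites \<open>X2\<close> as a cycle of positions along
    \<open>X\<close>, that is, of first coordinates in the torus.\<close>
  define pos where "pos = inv_into {..<2 ^ k} ((!) X)"
  have bij: "bij_betw ((!) X) {..<2 ^ k} {x. length x = k}"
    using X'(1) lens(1) by (intro bij_betw_nth) (auto simp: ham_def)
  have pos: "length x = k \<Longrightarrow> X ! pos x = x" "i < 2 ^ k \<Longrightarrow> pos (X ! i) = i" for x i
    using bij unfolding pos_def
    by (auto simp: bij_betw_inv_into_left bij_betw_inv_into_right)
  have bij': "bij_betw pos {x. length x = k} {..<2 ^ k}"
    unfolding pos_def by (rule bij_betw_inv_into[OF bij])
  define g where "g = map pos X2"
  have ne: "X2 \<noteq> []" using X2 ham_nonempty by blast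
  have g: "distinct g" "set g = {..<2 ^ k}" "hd g = 0" "last g = p"
    using X2(1) bij' ne pos(2)[of 0] pos(2)[of p] p X'
    by (auto simp: g_def ham_def distinct_map bij_betw_def hd_map last_map)
  have even: "even ((2::nat) ^ m)" using m by simp
  show thesis
  proof (rule torus_three_cycles[OF B4 even torus_conditions(2-4) p g])
    fix Z1 Z2 Z3 :: "(nat \<times> nat) list"
    assume Z: "distinct Z1" "set Z1 = {..<2 ^ k} \<times> {..<2 ^ m}"
        "distinct Z2" "set Z2 = {..<2 ^ k} \<times> {..<2 ^ m}"
        "distinct Z3" "set Z3 = {..<2 ^ k} \<times> {..<2 ^ m}"
      and h: "\<And>i c. i < 2 ^ k \<Longrightarrow> c < 2 ^ m \<Longrightarrow>
        {(i, c), (Suc i mod 2 ^ k, c)} \<in> cedges Z1 \<union> cedges Z2 \<union> cedges Z3"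
      and v: "\<And>i c. i < 2 ^ k \<Longrightarrow> c < 2 ^ m \<Longrightarrow>
        {(i, c), (i, Suc c mod 2 ^ m)} \<in> cedges Z1 \<union> cedges Z2 \<union> cedges Z3"
      and d: "\<And>a b c. {a, b} \<in> cedges g \<Longrightarrow> c < 2 ^ m \<Longrightarrow>
        {(a, c), (b, c)} \<in> cedges Z1 \<union> cedges Z2 \<union> cedges Z3"
    let ?U = "cedges (map coord Z1) \<union> cedges (map coord Z2) \<union> cedges (map coord Z3)"
    have Zne: "set Z1 \<noteq> {}" "set Z2 \<noteq> {}" "set Z3 \<noteq> {}" unfolding Z by (auto simp: lessThan_empty_iff)
    have U: "{coord x, coord y} \<in> ?U" if "{x, y} \<in> cedges Z1 \<union> cedges Z2 \<union> cedges Z3" for x y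
      using that coord_edge Zne by blast
    show thesis
    proof (rule that)
      show "ham (k + m) (map coord Z1)" "ham (k + m) (map coord Z2)" "ham (k + m) (map coord Z3)"
        using Z by (auto intro!: ham_coord)
      show "covers_right k Y ?U" using v U by (intro covers_rightI) blast
      have "covers_left m X ?U" using h U by (intro covers_leftI) blast
      then show "covers_left m X1 ?U" using X'(2) by (simp add: covers_left_def)
      show "covers_left m X2 ?U"
        unfolding covers_left_def
      proof (intro allI impI)
        fix a a' and b :: "bool list" assume *: "{a, a'} \<in> cedges X2" "length b = m"
        then have "b \<in> set Y" using Y by (simp add: ham_def)
        then obtain c where c: "c < 2 ^ m" "b = Y ! c" by (metis in_set_conv_nth lens(2))
        have "{a, a'} \<subseteq> set X2" using * ne cedges_subset by metis
        then have "length a = k" "length a' = k" using X2(1) by (auto simp: ham_def)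
        moreover have "{pos a, pos a'} \<in> cedges g"
          using * ne by (auto simp: g_def cedges_map image_iff intro!: bexI[of _ "{a, a'}"])
        ultimately show "{a @ b, a' @ b} \<in> ?U"
          using U[OF d[OF _ c(1)], of "pos a" "pos a'"] by (simp add: coord_def pos c)
      qed
    qed
  qed
qed

section \<open>Induction on the dimension\<close>

lemma lists_length_2:
  "{x :: bool list. length x = 2} = {[False, False], [True, False], [True, True], [False, True]}"
  by (auto simp: length_Suc_conv numeral_2_eq_2)

lemma ham_decomposition_2:
  "ham_decomposition 2 [[[False, False], [True, False], [True, True], [False, True]]]"
proof -
  have "edges (hypercube 2) \<subseteq> cedges [[False, False], [True, False], [True, True], [False, True]]"
  proof
    fix e assume "e \<in> edges (hypercube 2)"
    then obtain i and x :: "bool list" where "e = {x, x[i := True]}" "i < 2" "x \<in> {x. length x = 2}" "\<not> x ! i"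
      unfolding edges_hypercube_flip by auto
    moreover from this have "(i, x) \<in> {(0, [False, False]), (0, [False, True]),
        (1, [False, False]), (1, [True, False])}"
      unfolding lists_length_2 less_2_cases_iff by auto
    ultimately show "e \<in> cedges [[False, False], [True, False], [True, True], [False, True]]"
      by (elim insertE) (simp_all add: cedges_def insert_commute)
  qed
  then show ?thesis using lists_length_2 by (simp add: ham_decomposition_def ham_def)
qed

lemma covers_imp_ham_decomposition:
  assumes LK: "ham_decomposition k LK" and Lm: "ham_decomposition m Lm"
    and L: "length L = (k + m) div 2" "\<And>Z. Z \<in> set L \<Longrightarrow> ham (k + m) Z"
    and l: "\<And>X. X \<in> set LK \<Longrightarrow> covers_left m X (\<Union>Z\<in>set L. cedges Z)"
    and r: "\<And>Y. Y \<in> set Lm \<Longrightarrow> covers_right k Y (\<Union>Z\<in>set L. cedges Z)"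
  shows "ham_decomposition (k + m) L"
  unfolding ham_decomposition_def
proof (intro conjI ballI subsetI)
  fix e assume "e \<in> edges (hypercube (k + m))"
  then show "e \<in> (\<Union>Z\<in>set L. cedges Z)"
  proof (cases rule: edge_hypercube_appendE)
    case (left a a' b)
    then obtain X where "X \<in> set LK" "{a, a'} \<in> cedges X" using LK by (auto simp: ham_decomposition_def)
    then show ?thesis using l[of X] left unfolding covers_left_def by blast
  next
    case (right a b b')
    then obtain Y where "Y \<in> set Lm" "{b, b'} \<in> cedges Y" using Lm by (auto simp: ham_decomposition_def)
    then show ?thesis using r[of Y] right unfolding covers_right_def by blast
  qed
qed (use L in auto)

lemma covers_left_mono: "covers_left m X U \<Longrightarrow> U \<subseteq> V \<Longrightarrow> covers_left m X V"
  and covers_right_mono: "covers_right k Y U \<Longrightarrow> U \<subseteq> V \<Longrightarrow> covers_right k Y V"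
  unfolding covers_left_def covers_right_def by blast+

theorem hypercube_ham_decomposition:
  assumes "even n" "0 < n" obtains L where "ham_decomposition n L"
proof -
  have "\<exists>L. ham_decomposition n L" using assms
  proof (induction n rule: less_induct)
    case (less n)
    have "n = 2 \<or> 4 \<le> n \<and> 4 dvd n \<or> 6 \<le> n \<and> \<not> 4 dvd n" using less.prems by presburger
    then consider "n = 2" | "4 \<le> n" "4 dvd n" | "6 \<le> n" "\<not> 4 dvd n" by blast
    then show ?case
    proof cases
      case 1
      then show ?thesis using ham_decomposition_2 by blast
    next
      case 2
      define k where "k = n div 4"
      have n: "n = 2 * k + 2 * k" and k: "1 \<le> k" using 2 by (auto simp: k_def)
      obtain LK where LK: "ham_decomposition (2 * k) LK" using less.IH[of "2 * k"] n k by auto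
      have LK': "length LK = k" "\<And>i. i < k \<Longrightarrow> ham (2 * k) (LK ! i)"
        using LK by (auto simp: ham_decomposition_def)
      \<comment> \<open>Both factors have \<open>k\<close> cycles, paired index by index; each pair
        yields two of the \<open>2 * k\<close> cycles.\<close>
      have "\<exists>Z1 Z2. i < k \<longrightarrow> ham n Z1 \<and> ham n Z2 \<and>
          covers_left (2 * k) (LK ! i) (cedges Z1 \<union> cedges Z2) \<and>
          covers_right (2 * k) (LK ! i) (cedges Z1 \<union> cedges Z2)" for i
      proof (cases "i < k")
        case True
        interpret ham_product "2 * k" "2 * k" "LK ! i" "LK ! i"
          using LK'(2)[OF True] k by unfold_locales auto
        show ?thesis using two_cycles n by metis
      qed simp
      then obtain F G where FG: "\<And>i. i < k \<Longrightarrow> ham n (F i) \<and> ham n (G i) \<and>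
          covers_left (2 * k) (LK ! i) (cedges (F i) \<union> cedges (G i)) \<and>
          covers_right (2 * k) (LK ! i) (cedges (F i) \<union> cedges (G i))" by metis
      let ?L = "map F [0..<k] @ map G [0..<k]"
      have sub: "cedges (F i) \<union> cedges (G i) \<subseteq> (\<Union>Z\<in>set ?L. cedges Z)" if "i < k" for i
        using that by force
      have "ham_decomposition (2 * k + 2 * k) ?L"
      proof (rule covers_imp_ham_decomposition[OF LK LK])
        show "covers_left (2 * k) X (\<Union>Z\<in>set ?L. cedges Z)" if "X \<in> set LK" for X
          using that LK'(1) FG sub by (metis covers_left_mono in_set_conv_nth)
        show "covers_right (2 * k) X (\<Union>Z\<in>set ?L. cedges Z)" if "X \<in> set LK" for X
          using that LK'(1) FG sub by (metis covers_right_mono in_set_conv_nth)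
      qed (use FG n in auto)
      then show ?thesis using n by auto
    next
      case 3
      define k where "k = n div 4"
      define K m where "K = 2 * k + 2" and "m = 2 * k"
      have "n = 4 * k + 2" and k: "1 \<le> k" using 3 less.prems(1) unfolding k_def by presburger+
      then have n: "n = K + m" by (simp add: K_def m_def)
      obtain LK where LK: "ham_decomposition K LK" using less.IH[of K] n k by (auto simp: K_def m_def)
      obtain Lm where Lm: "ham_decomposition m Lm" using less.IH[of m] n k by (auto simp: K_def m_def)
      have LK': "length LK = Suc k" "\<And>i. i < Suc k \<Longrightarrow> ham K (LK ! i)"
        using LK by (auto simp: ham_decomposition_def K_def)
      have Lm': "length Lm = k" "\<And>i. i < k \<Longrightarrow> ham m (Lm ! i)"
        using Lm by (auto simp: ham_decomposition_def m_def)
      \<comment> \<open>The factors have \<open>k + 1\<close> and \<open>k\<close> cycles. Cycles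
        \<open>0\<close> and \<open>1\<close> of the larger share cycle \<open>0\<close> of the
        smaller and yield three; for \<open>i \<ge> 1\<close>, cycle \<open>i + 1\<close> is paired
        with cycle \<open>i\<close>. This makes \<open>3 + 2 * (k - 1) = 2 * k + 1\<close>
        cycles.\<close>
      have "\<exists>Z1 Z2. i < k \<longrightarrow> ham n Z1 \<and> ham n Z2 \<and>
          covers_left m (LK ! Suc i) (cedges Z1 \<union> cedges Z2) \<and>
          covers_right K (Lm ! i) (cedges Z1 \<union> cedges Z2)" for i
      proof (cases "i < k")
        case True
        interpret ham_product K m "LK ! Suc i" "Lm ! i"
          using LK'(2) Lm'(2) True k by unfold_locales (auto simp: K_def m_def)
        show ?thesis using two_cycles n by metis
      qed simp
      then obtain F G where FG: "\<And>i. i < k \<Longrightarrow> ham n (F i) \<and> ham n (G i) \<and>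
          covers_left m (LK ! Suc i) (cedges (F i) \<union> cedges (G i)) \<and>
          covers_right K (Lm ! i) (cedges (F i) \<union> cedges (G i))" by metis
      have part: "even K" "0 < K div 2" "1 < K div 2" using k by (auto simp: K_def)
      obtain Z1 Z2 Z3 where Z: "ham n Z1" "ham n Z2" "ham n Z3"
        "covers_left m (LK ! 0) (cedges Z1 \<union> cedges Z2 \<union> cedges Z3)"
        "covers_left m (LK ! 1) (cedges Z1 \<union> cedges Z2 \<union> cedges Z3)"
        "covers_right K (Lm ! 0) (cedges Z1 \<union> cedges Z2 \<union> cedges Z3)"
        using three_cycles[of K "LK ! 0" "LK ! 1" m "Lm ! 0"] LK'(2) Lm'(2) k n
          ham_decomposition_partition[OF LK part(1,2)] ham_decomposition_partition[OF LK part(1,3)] part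
        by (auto simp: K_def m_def)
      let ?L = "[Z1, Z2, Z3] @ map F [1..<k] @ map G [1..<k]"
      have sub: "cedges (F i) \<union> cedges (G i) \<subseteq> (\<Union>Z\<in>set ?L. cedges Z)" if "1 \<le> i" "i < k" for i
        using that by force
      have sub3: "cedges Z1 \<union> cedges Z2 \<union> cedges Z3 \<subseteq> (\<Union>Z\<in>set ?L. cedges Z)" by auto
      have "ham_decomposition (K + m) ?L"
      proof (rule covers_imp_ham_decomposition[OF LK Lm])
        show "length ?L = (K + m) div 2" using k by (simp add: K_def m_def)
        show "covers_left m X (\<Union>Z\<in>set ?L. cedges Z)" if X: "X \<in> set LK" for X
        proof -
          obtain i where i: "i < Suc k" "X = LK ! i" using X LK'(1) by (metis in_set_conv_nth)
          consider "i = 0" | "i = 1" | j where "i = Suc j" "1 \<le> j" "j < k" using i(1)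
            by (cases i) (auto, metis One_nat_def Suc_leI gr0I)
          then show ?thesis
          proof cases
            case 1 then show ?thesis using covers_left_mono[OF Z(4) sub3] i by simp
          next
            case 2 then show ?thesis using covers_left_mono[OF Z(5) sub3] i by simp
          next
            case 3
            then show ?thesis
              using covers_left_mono[OF _ sub[OF 3(2,3)]] FG[OF 3(3)] i(2) by blast
          qed
        qed
        show "covers_right K Y (\<Union>Z\<in>set ?L. cedges Z)" if Y: "Y \<in> set Lm" for Y
        proof -
          obtain i where i: "i < k" "Y = Lm ! i" using Y Lm'(1) by (metis in_set_conv_nth)
          show ?thesis
          proof (cases "i = 0")
            case True then show ?thesis using covers_right_mono[OF Z(6) sub3] i by simp
          next
            case False
            then have "1 \<le> i" by simp
            then show ?thesis
              using covers_right_mono[OF _ sub[OF _ i(1)]] FG[OF i(1)] i(2) by blast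
          qed
        qed
      qed (use FG Z n in auto)
      then show ?thesis using n by auto
    qed
  qed
  then show thesis using that by blast
qed

section \<open>Walks that return late\<close>

lemma cedges_conv_wedges: "xs \<noteq> [] \<Longrightarrow> cedges xs = wedges (xs @ [hd xs])"
  by (simp add: cedges_def wedges_append)

text \<open>Each walk is cut every \<open>l\<close> steps; consecutive pieces share an end vertex,
  so a piece takes \<open>l + 1\<close> entries. Pieces are paths because no vertex recurs within
  \<open>l\<close> steps. As a decomposition must also cover the vertices, each vertex is assumed to
  lie on an edge.\<close>

lemma walks_imp_path_decomposition:
  fixes G :: "'a graph" and W :: "nat \<Rightarrow> 'a list"
  assumes l: "0 < l" "l dvd M"
    and len: "\<And>c. c < r \<Longrightarrow> length (W c) = Suc M"
    and sep: "\<And>c i j. c < r \<Longrightarrow> i < j \<Longrightarrow> j \<le> i + l \<Longrightarrow> j \<le> M \<Longrightarrow> W c ! i \<noteq> W c ! j"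
    and cover: "edges G \<subseteq> (\<Union>c<r. wedges (W c))"
    and card: "card (edges G) = r * M"
    and verts: "\<Union> (edges G) = verts G"
  shows "\<exists>\<P>. edge_decomposition G \<P> \<and> (\<forall>P\<in>\<P>. is_path l P)"
proof -
  obtain q where M: "M = l * q" using l(2) by blast
  define I where "I = {..<r} \<times> {..<q}"
  define p where "p = (\<lambda>(c, k). take (Suc l) (drop (k * l) (W c)))"
  have kl: "k * l + l \<le> M" if "k < q" for k
    using mult_le_mono2[of "Suc k" q l] that by (simp add: M mult.commute)
  have p_len: "length (p ck) = Suc l" if "ck \<in> I" for ck
    using that kl len by (auto simp: I_def p_def split: prod.splits) fastforce
  have p_nth: "p (c, k) ! i = W c ! (k * l + i)" if "c < r" "k < q" "i \<le> l" for c k i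
    using that kl[of k] len[of c] by (simp add: p_def add.commute)
  have p_dist: "distinct (p ck)" if ck: "ck \<in> I" for ck
  proof -
    obtain c k where [simp]: "ck = (c, k)" "c < r" "k < q" using ck by (auto simp: I_def)
    have "p ck ! i \<noteq> p ck ! j" if "i < j" "j \<le> l" for i j
      using sep[of c "k * l + i" "k * l + j"] that kl[of k] by (simp add: p_nth)
    then show ?thesis
      unfolding distinct_conv_nth p_len[OF ck] by (metis less_Suc_eq_le linorder_neqE_nat)
  qed
  have "edges G \<subseteq> (\<Union>ck\<in>I. wedges (p ck))"
  proof
    fix e assume "e \<in> edges G"
    then obtain c where c: "c < r" "e \<in> wedges (W c)" using cover by blast
    then obtain i where i: "i < M" "e = {W c ! i, W c ! Suc i}"
      by (auto simp: path_on_def len)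
    define k where "k = i div l"
    have k: "k < q" using i(1) l by (simp add: k_def M less_mult_imp_div_less mult.commute)
    have r: "i mod l < l" "i = k * l + i mod l" using l by (simp_all add: k_def)
    have "e = {p (c, k) ! (i mod l), p (c, k) ! Suc (i mod l)}"
      using i(2) r p_nth[OF c(1) k] by simp
    moreover have "(c, k) \<in> I" using c k by (simp add: I_def)
    ultimately show "e \<in> (\<Union>ck\<in>I. wedges (p ck))"
      using wedges_nth[of "i mod l" "p (c, k)"] p_len r by auto
  qed
  moreover have "card (edges G) = card I * l" by (simp add: card I_def M)
  moreover have "card (wedges (p ck)) \<le> l" if "ck \<in> I" for ck
    using card_wedges_le[of "p ck"] p_len[OF that] by simp
  ultimately have U: "(\<Union>ck\<in>I. wedges (p ck)) = edges G"
    and disj: "\<And>i j. i \<in> I \<Longrightarrow> j \<in> I \<Longrightarrow> i \<noteq> j \<Longrightarrow> wedges (p i) \<inter> wedges (p j) = {}"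
    using cover_imp_partition[of I "\<lambda>ck. wedges (p ck)" l "edges G"] by (simp_all add: I_def)
  have V: "\<Union> (wedges (p ck)) = set (p ck)" if ck: "ck \<in> I" for ck
  proof
    show "\<Union> (wedges (p ck)) \<subseteq> set (p ck)" using wedges_subset by blast
    show "set (p ck) \<subseteq> \<Union> (wedges (p ck))"
    proof
      fix v assume "v \<in> set (p ck)"
      then obtain i where i: "i \<le> l" "v = p ck ! i" using p_len[OF ck] by (metis in_set_conv_nth less_Suc_eq_le)
      show "v \<in> \<Union> (wedges (p ck))"
        using wedges_nth[of i "p ck"] wedges_nth[of "i - 1" "p ck"] i l(1) p_len[OF ck]
        by (cases "i < l") (auto intro!: UnionI)
    qed
  qed
  show ?thesis
  proof (intro exI[of _ "(\<lambda>ck. path_on (p ck)) ` I"] conjI ballI)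
    show "is_path l P" if "P \<in> (\<lambda>ck. path_on (p ck)) ` I" for P
    proof -
      from that obtain ck where "ck \<in> I" "P = path_on (p ck)" by blast
      then show ?thesis unfolding is_path_def using p_dist p_len by blast
    qed
    have vp: "verts (path_on vs) = set vs" for vs :: "'a list" by (simp add: path_on_def)
    have "(\<Union>ck\<in>I. set (p ck)) = (\<Union>ck\<in>I. \<Union> (wedges (p ck)))" using V by simp
    also have "\<dots> = \<Union> (edges G)" using U by blast
    finally have "(\<Union>ck\<in>I. set (p ck)) = verts G" by (simp add: verts)
    then show "edge_decomposition G ((\<lambda>ck. path_on (p ck)) ` I)"
      unfolding edge_decomposition_def subgraph_def
    proof (intro conjI ballI impI)
      fix H H'
      assume "H \<in> (\<lambda>ck. path_on (p ck)) ` I" "H' \<in> (\<lambda>ck. path_on (p ck)) ` I" "H \<noteq> H'"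
      then show "edges H \<inter> edges H' = {}" using disj by blast
    qed (use U in \<open>auto simp: vp\<close>)
  qed
qed

lemma Union_edges_hypercube:
  assumes "0 < n" shows "\<Union> (edges (hypercube n)) = verts (hypercube n)"
proof
  show "\<Union> (edges (hypercube n)) \<subseteq> verts (hypercube n)" by (auto simp: hypercube_def)
  show "verts (hypercube n) \<subseteq> \<Union> (edges (hypercube n))"
  proof
    fix x assume "x \<in> verts (hypercube n)"
    then have x: "length x = n" by (simp add: hypercube_def)
    let ?z = "x[0 := False]"
    have "{?z, ?z[0 := True]} \<in> edges (hypercube n)"
      unfolding edges_hypercube_flip using x assms by (auto intro!: image_eqI[of _ _ "(0, ?z)"])
    moreover have "x \<in> {?z, ?z[0 := True]}"
      using x assms by (cases x; cases "hd x") auto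
    ultimately show "x \<in> \<Union> (edges (hypercube n))" by blast
  qed
qed

section \<open>Lists whose repetitions are far apart\<close>

definition separated :: "nat \<Rightarrow> 'a list \<Rightarrow> bool" where
  "separated l xs \<longleftrightarrow> (\<forall>i j. i < j \<longrightarrow> j < length xs \<longrightarrow> xs ! i = xs ! j \<longrightarrow> l < j - i)"

lemma separated_distinct: "distinct xs \<Longrightarrow> separated l xs"
  by (auto simp: separated_def distinct_conv_nth)

lemma separated_append:
  assumes "separated l xs" "separated l ys" "set xs \<inter> set ys = {}"
  shows "separated l (xs @ ys)"
  unfolding separated_def
proof (intro allI impI)
  fix i j assume ij: "i < j" "j < length (xs @ ys)" "(xs @ ys) ! i = (xs @ ys) ! j"
  consider "j < length xs" | "length xs \<le> i" | "i < length xs" "length xs \<le> j" by linarith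
  then show "l < j - i"
  proof cases
    case 1 then show ?thesis using assms(1) ij by (simp add: separated_def nth_append)
  next
    case 2
    then show ?thesis
      using assms(2)[unfolded separated_def, rule_format, of "i - length xs" "j - length xs"] ij
      by (simp add: nth_append)
  next
    case 3
    then have "xs ! i = ys ! (j - length xs)" using ij(3) by (simp add: nth_append)
    moreover have "j - length xs < length ys" using 3 ij(2) by auto
    ultimately have "xs ! i \<in> set ys" by (metis nth_mem)
    moreover have "xs ! i \<in> set xs" using 3 by simp
    ultimately show ?thesis using assms(3) by blast
  qed
qed

text \<open>Positions on opposite sides of \<open>zs\<close> are more than \<open>l\<close> apart
  because \<open>zs\<close> is long; any other pair lies within \<open>xs @ zs\<close> or
  \<open>zs @ ys\<close>.\<close>

lemma separated_glue:
  assumes "separated l (xs @ zs)" "separated l (zs @ ys)" "l \<le> length zs"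
  shows "separated l (xs @ zs @ ys)"
  unfolding separated_def
proof (intro allI impI)
  fix i j assume ij: "i < j" "j < length (xs @ zs @ ys)" "(xs @ zs @ ys) ! i = (xs @ zs @ ys) ! j"
  consider "j < length (xs @ zs)" | "length xs \<le> i" | "i < length xs" "length (xs @ zs) \<le> j"
    by linarith
  then show "l < j - i"
  proof cases
    case 1
    then have "(xs @ zs) ! i = (xs @ zs) ! j"
      using ij by (metis append.assoc nth_append_left less_trans)
    then show ?thesis using assms(1) ij 1 by (simp add: separated_def)
  next
    case 2
    then show ?thesis
      using assms(2)[unfolded separated_def, rule_format, of "i - length xs" "j - length xs"] ij
      by (simp add: nth_append_right)
  next
    case 3 then show ?thesis using assms(3) by simp
  qed
qed

lemma separated_map:
  assumes "separated l xs" "inj_on f (set xs)" shows "separated l (map f xs)"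
  using assms unfolding separated_def inj_on_def by auto

text \<open>The walk goes once around the cycle \<open>x\<close>, zigzagging between the layers \<open>1\<close> and \<open>2\<close> of a
  4-cycle. Just before \<open>x (3 * j)\<close>, for \<open>1 \<le> j < h\<close>, it steps out to layer \<open>0\<close> or \<open>3\<close>, alternately,
  and there runs through the Hamiltonian cycle \<open>g j\<close>. In that layer it visits \<open>x (3 * j - 1)\<close> twice,
  hence the assumption that this vertex does not occur too early in \<open>g j\<close>.\<close>

locale hypercube_walk =
  fixes A h l :: nat and x :: "nat \<Rightarrow> 'v" and g :: "nat \<Rightarrow> 'v list"
  assumes A: "even A" "3 * h \<le> A" and h: "2 \<le> h" and l: "l < A"
    and x: "inj_on x {..<A}" "x A = x 0"
    and g: "\<And>j. 1 \<le> j \<Longrightarrow> j < h \<Longrightarrow> distinct (g j) \<and> length (g j) = A \<and> hd (g j) = x (3 * j)"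
    and far: "\<And>j D. 1 \<le> j \<Longrightarrow> j < h \<Longrightarrow> D < A \<Longrightarrow> g j ! D = x (3 * j - 1) \<Longrightarrow> l \<le> D"
begin

text \<open>Steps from even \<open>t\<close> switch layers, steps from odd \<open>t\<close> follow
  the cycle \<open>x\<close>. The layers run through 2, 1, 1, 2 periodically, which closes up after
  \<open>2 * A\<close> steps because \<open>A\<close> is even.\<close>

definition zig :: "nat \<Rightarrow> 'v \<times> nat" where
  "zig t = (x (t div 2), if even ((t + 1) div 2) then 2 else 1)"

text \<open>The zigzag arrives at \<open>x (3 * j - 1)\<close> in layer 2 for odd \<open>j\<close>,
  next to layer 3, and in layer 1 for even \<open>j\<close>, next to layer 0. The odd spacing 3
  causes this alternation, which keeps the detours of neighbouring blocks in different
  layers.\<close>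

definition side :: "nat \<Rightarrow> nat" where
  "side j = (if even j then 0 else 3)"

text \<open>The cuts keep both visits of a detour to a vertex inside one block and make neighbouring
  blocks disjoint. The last branch serves \<open>j = h\<close>.\<close>

definition block :: "nat \<Rightarrow> ('v \<times> nat) list" where
  "block j =
    (if j = 0 then map zig [0..<5]
     else if j < h then
       ((x (3 * j - 1), side j) # map (\<lambda>v. (v, side j)) (g j) @ [(x (3 * j), side j)])
         @ map zig [6 * j + 1..<6 * j + 5]
     else map zig [6 * h - 1..<2 * A + 1])"

definition walk :: "('v \<times> nat) list" where
  "walk = concat (map block [0..<Suc h])"

lemma zig_layer: "snd (zig t) \<in> {1, 2}"
  by (simp add: zig_def)

lemma zig_end: "zig (2 * A) = zig 0"
  using A x by (simp add: zig_def)

lemma zig_inj: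
  assumes "zig s = zig t" "s < 2 * A" "t < 2 * A" shows "s = t"
proof -
  have "x (s div 2) = x (t div 2)"
    using arg_cong[OF assms(1), of fst] unfolding zig_def fst_conv .
  moreover have "s div 2 < A" "t div 2 < A" using assms by linarith+
  ultimately have half: "s div 2 = t div 2" using inj_onD[OF x(1)] by simp
  have parity: "even ((s + 1) div 2) = even ((t + 1) div 2)"
    using arg_cong[OF assms(1), of snd] unfolding zig_def snd_conv
    by (metis num.distinct(1) numeral_eq_one_iff)
  define a where "a = s div 2"
  have "s = 2 * a + s mod 2" unfolding a_def by simp
  moreover have "t = 2 * a + t mod 2" unfolding a_def half by simp
  ultimately have "s = 2 * a \<or> s = 2 * a + 1" "t = 2 * a \<or> t = 2 * a + 1" by linarith+
  then show ?thesis using parity by (elim disjE) simp_all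
qed

lemma zig_eq_iff:
  assumes "0 < s" "s < 2 * A" "t \<le> 2 * A" shows "zig s = zig t \<longleftrightarrow> s = t"
  using zig_inj[of s t] zig_inj[of s 0] zig_end assms by (cases "t = 2 * A") auto

lemma block_0: "block 0 = map zig [0..<5]"
  by (simp add: block_def)

lemma block_h: "block h = map zig [6 * h - 1..<2 * A + 1]"
  using h by (simp add: block_def del: upt_Suc)

lemma block_mid: "1 \<le> j \<Longrightarrow> j < h \<Longrightarrow> block j =
    ((x (3 * j - 1), side j) # map (\<lambda>v. (v, side j)) (g j) @ [(x (3 * j), side j)])
         @ map zig [6 * j + 1..<6 * j + 5]"
  by (simp add: block_def del: upt_Suc)

lemma length_block_mid: "1 \<le> j \<Longrightarrow> j < h \<Longrightarrow> length (block j) = A + 6"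
  using g[of j] by (simp add: block_mid)

lemma block_nonempty: "j \<le> h \<Longrightarrow> block j \<noteq> []"
  using A h by (auto simp: block_def)

lemma set_block_mid:
  "1 \<le> j \<Longrightarrow> j < h \<Longrightarrow> set (block j) \<subseteq> UNIV \<times> {side j} \<union> zig ` {6 * j + 1..<6 * j + 5}"
  by (auto simp: block_mid)

lemma last_block: "j < h \<Longrightarrow> last (block j) = zig (6 * j + 4)"
proof -
  assume j: "j < h"
  have *: "last (map zig [a..<Suc b]) = zig b" if "a \<le> b" for a b using that by simp
  show ?thesis
  proof (cases "j = 0")
    case True then show ?thesis using *[of 0 4] by (simp add: block_0)
  next
    case False
    then have "last (block j) = last (map zig [6 * j + 1..<Suc (6 * j + 4)])"
    proof -
      have "6 * j + 5 = Suc (6 * j + 4)" by simp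
      moreover have "1 \<le> j" using False by simp
      ultimately show ?thesis using block_mid[of j] j by (simp only: last_appendR) simp
    qed
    then show ?thesis using *[of "6 * j + 1" "6 * j + 4"] by simp
  qed
qed

text \<open>Blocks \<open>0\<close> and \<open>h\<close> are injective stretches of the zigzag. In a
  middle block, \<open>?q\<close> occurs at both ends of the loop, \<open>A > l\<close> steps apart,
  and the entry vertex \<open>?p\<close> recurs at position \<open>D\<close> of the loop,
  \<open>D + 1\<close> steps after its first visit, where \<open>l \<le> D\<close> by
  \<open>far\<close>.\<close>

lemma separated_block:
  assumes "j \<le> h" shows "separated l (block j)"
proof -
  consider "j = 0" | "j = h" | "1 \<le> j" "j < h" using assms by linarith
  then show ?thesis
  proof cases
    case 1
    have "inj_on zig {0..<5}" using zig_inj A h by (auto intro!: inj_onI)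
    then show ?thesis unfolding 1 block_0 by (intro separated_distinct) (simp add: distinct_map)
  next
    case 2
    have "inj_on zig {6 * h - 1..<2 * A + 1}"
    proof (rule inj_onI)
      fix s t assume "s \<in> {6 * h - 1..<2 * A + 1}" "t \<in> {6 * h - 1..<2 * A + 1}" "zig s = zig t"
      then have "0 < s" "s \<le> 2 * A" "0 < t" "t \<le> 2 * A" "zig s = zig t" using h by auto
      then show "s = t"
        using zig_eq_iff[of s t] zig_eq_iff[of t s] by (metis le_neq_implies_less)
    qed
    then show ?thesis
      unfolding 2 block_h by (intro separated_distinct) (simp add: distinct_map del: upt_Suc)
  next
    case 3
    define G where "G = map (\<lambda>v. (v, side j)) (g j)"
    let ?p = "(x (3 * j - 1), side j)" and ?q = "(x (3 * j), side j)"
    have G: "distinct G" "length G = A"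
      using g[OF 3] by (auto simp: G_def distinct_map intro!: inj_onI)
    have A0: "0 < A" using l by simp
    have G0: "G ! 0 = ?q" using g[OF 3] A0 by (simp add: G_def hd_conv_nth[symmetric])
        (metis hd_conv_nth length_0_conv less_irrefl)
    have far': "l \<le> D" if "D < A" "G ! D = ?p" for D
      using that far[OF 3, of D] g[OF 3] by (simp add: G_def)
    have "3 * j - 1 < A" "3 * j < A" "3 * j - 1 \<noteq> 3 * j" using 3 A by linarith+
    then have pq: "?p \<noteq> ?q" using x(1) by (auto simp: inj_on_def)
    have "separated l (?p # G @ [?q])"
      unfolding separated_def
    proof (intro allI impI)
      fix a b assume ab: "a < b" "b < length (?p # G @ [?q])" "(?p # G @ [?q]) ! a = (?p # G @ [?q]) ! b"
      show "l < b - a"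
      proof (cases "a = 0")
        case True
        then obtain b' where b': "b = Suc b'" "b' \<le> A" using ab G by (cases b) auto
        then have "(G @ [?q]) ! b' = ?p" using ab(3) True by simp
        then have "b' < A" "G ! b' = ?p" using b' pq G by (auto simp: nth_append split: if_splits)
        then show ?thesis using far' b' True by fastforce
      next
        case False
        then obtain a' b' where ab': "a = Suc a'" "b = Suc b'" "a' < b'" "b' \<le> A"
          using ab G by (cases a; cases b) auto
        then have eq: "G ! a' = (G @ [?q]) ! b'" using ab(3) G by (simp add: nth_append)
        show ?thesis
        proof (cases "b' < A")
          case True
          then have "G ! a' = G ! b'" using eq G by (simp add: nth_append)
          then show ?thesis using G True ab' by (simp add: nth_eq_iff_index_eq)
        next
          case False
          then have b: "b' = A" using ab' by simp
          then have "G ! a' = G ! 0" using eq G G0 by (simp add: nth_append)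
          then have "a' = 0" using G ab' b A0 nth_eq_iff_index_eq[of G a' 0] by simp
          then show ?thesis using ab' b l by simp
        qed
      qed
    qed
    moreover have "separated l (map zig [6 * j + 1..<6 * j + 5])"
    proof (rule separated_distinct)
      have "inj_on zig {6 * j + 1..<6 * j + 5}" using zig_inj 3 A by (auto intro!: inj_onI)
      then show "distinct (map zig [6 * j + 1..<6 * j + 5])" by (simp add: distinct_map del: upt_Suc)
    qed
    moreover have "set (?p # G @ [?q]) \<inter> set (map zig [6 * j + 1..<6 * j + 5]) = {}"
      using zig_layer by (auto simp: G_def side_def zig_def split: if_splits)
    ultimately show ?thesis
      unfolding block_mid[OF 3] G_def[symmetric] by (rule separated_append)
  qed
qed

lemma block_disjoint:
  assumes "Suc j \<le> h" shows "set (block j) \<inter> set (block (Suc j)) = {}"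
proof -
  \<comment> \<open>The zigzag repeats a vertex only at times \<open>0\<close> and
    \<open>2 * A\<close>, so it is enough that one of the two sets of times avoids both. A middle
    block always does.\<close>
  have zz: "zig ` S \<inter> zig ` T = {}"
    if "S \<inter> T = {}" "S \<subseteq> {..2 * A}" "T \<subseteq> {0<..<2 * A}" for S T
  proof -
    have "zig s \<noteq> zig t" if st: "s \<in> S" "t \<in> T" for s t
    proof -
      have "0 < t" "t < 2 * A" using \<open>T \<subseteq> {0<..<2 * A}\<close> st by auto
      moreover have "s \<le> 2 * A" "t \<noteq> s"
        using \<open>S \<subseteq> {..2 * A}\<close> \<open>S \<inter> T = {}\<close> st by auto
      ultimately show ?thesis using zig_eq_iff[of t s] by metis
    qed
    then show ?thesis by blast
  qed
  have zs: "zig ` S \<inter> UNIV \<times> {side i} = {}" for S i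
    using zig_layer by (auto simp: side_def zig_def split: if_splits)
  have ss: "(UNIV :: 'v set) \<times> {side j} \<inter> UNIV \<times> {side (Suc j)} = {}" by (auto simp: side_def)
  have disj: "U \<inter> V = {}" if "U \<subseteq> P \<union> Q" "V \<subseteq> P' \<union> Q'"
    "P \<inter> P' = {}" "P \<inter> Q' = {}" "Q \<inter> P' = {}" "Q \<inter> Q' = {}" for U V P Q P' Q' :: "('v \<times> nat) set"
    using that by blast
  have zs': "UNIV \<times> {side i} \<inter> zig ` S = {}" for S i using zs by blast
  consider "j = 0" | "1 \<le> j" "Suc j < h" | "1 \<le> j" "Suc j = h" using assms h by linarith
  then show ?thesis
  proof cases
    case 1
    have z: "zig ` {0..<5} \<inter> zig ` {6 * 1 + 1..<6 * 1 + 5} = {}" using A h by (intro zz) auto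
    have s: "set (block 0) \<subseteq> {} \<union> zig ` {0..<5}" by (auto simp: block_0)
    have "1 < h" using h by simp
    then have "set (block 0) \<inter> set (block 1) = {}"
      by (intro disj[OF s set_block_mid _ _ zs z]) simp_all
    then show ?thesis using 1 by simp
  next
    case 2
    have "zig ` {6 * j + 1..<6 * j + 5} \<inter> zig ` {6 * Suc j + 1..<6 * Suc j + 5} = {}"
      using A 2 by (intro zz) auto
    then show ?thesis
      using disj[OF set_block_mid[of j] set_block_mid[of "Suc j"] ss zs' zs] 2 by simp
  next
    case 3
    have "zig ` {6 * h - 1..<2 * A + 1} \<inter> zig ` {6 * j + 1..<6 * j + 5} = {}"
      using A 3 by (intro zz) auto
    then have z: "zig ` {6 * j + 1..<6 * j + 5} \<inter> zig ` {6 * h - 1..<2 * A + 1} = {}" by blast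
    have s: "set (block h) \<subseteq> {} \<union> zig ` {6 * h - 1..<2 * A + 1}" by (auto simp: block_h)
    have "j < h" using 3 by simp
    then have "set (block j) \<inter> set (block h) = {}"
      by (intro disj[OF set_block_mid[OF 3(1)] s _ zs' _ z]) simp_all
    then show ?thesis using 3 by simp
  qed
qed

text \<open>A vertex recurs either within a block or in blocks that are not neighbours, and then a
  whole middle block of \<open>A + 6 > l\<close> entries lies in between. The induction keeps the
  last block apart, as the overlap for gluing on the next one.\<close>

lemma separated_walk: "separated l walk"
proof -
  have "separated l (concat (map block [0..<j]) @ block j)" if "j \<le> h" for j
    using that
  proof (induction j)
    case 0 then show ?case using separated_block[of 0] by simp
  next
    case (Suc j)
    have two: "separated l (block j @ block (Suc j))"
      using separated_append[OF separated_block separated_block block_disjoint] Suc.prems by simp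
    show ?case
    proof (cases "j = 0")
      case True then show ?thesis using two by simp
    next
      case False
      then have "l \<le> length (block j)" using length_block_mid[of j] Suc.prems l by simp
      then show ?thesis using separated_glue[OF Suc.IH two] Suc.prems by simp
    qed
  qed
  from this[of h] show ?thesis by (simp add: walk_def)
qed

text \<open>The zigzag has \<open>2 * A\<close> steps, and each of the \<open>h - 1\<close> detours
  replaces three of them by three others and a full turn of \<open>A\<close> steps.\<close>

lemma length_walk: "length walk = Suc ((h + 1) * A)"
proof -
  have "length (concat (map block [0..<Suc j])) = 5 + j * (A + 6)" if "j < h" for j
    using that by (induction j) (simp_all add: block_0 length_block_mid)
  from this[of "h - 1"] have "length (concat (map block [0..<h])) = 5 + (h - 1) * (A + 6)"
    using h by simp
  moreover have "length (block h) = 2 * A + 1 - (6 * h - 1)" by (simp add: block_h del: upt_Suc)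
  moreover have "walk = concat (map block [0..<h]) @ block h" by (simp add: walk_def)
  ultimately have "length walk = 5 + (h - 1) * (A + 6) + (2 * A + 1 - (6 * h - 1))"
    by (simp only: length_append)
  moreover obtain k where "h = Suc k" using h by (cases h) auto
  ultimately show ?thesis using A by (simp add: algebra_simps)
qed

lemma wedges_block: "j \<le> h \<Longrightarrow> wedges (block j) \<subseteq> wedges walk"
  unfolding walk_def by (rule wedges_concat(1)) (auto intro!: block_nonempty)

lemma wedges_junction: "Suc j \<le> h \<Longrightarrow> {last (block j), hd (block (Suc j))} \<in> wedges walk"
  unfolding walk_def by (rule wedges_concat(2)) (auto intro!: block_nonempty)

lemma zig_edge:
  assumes "a \<le> t" "Suc t < b" shows "{zig t, zig (Suc t)} \<in> wedges (map zig [a..<b])"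
  using wedges_nth[of "t - a" "map zig [a..<b]"] assms by simp

lemma wedges_mid:
  assumes "1 \<le> j" "j < h"
  shows "wedges (map zig [6 * j + 1..<6 * j + 5]) \<subseteq> wedges walk"
    and "wedges (map (\<lambda>v. (v, side j)) (g j) @ [(x (3 * j), side j)]) \<subseteq> wedges walk"
    and "{(x (3 * j - 1), side j), (x (3 * j), side j)} \<in> wedges walk"
    and "{(x (3 * j), side j), zig (6 * j + 1)} \<in> wedges walk"
proof -
  let ?p = "(x (3 * j - 1), side j)" and ?q = "(x (3 * j), side j)"
  let ?C = "map (\<lambda>v. (v, side j)) (g j) @ [?q]" and ?Z = "map zig [6 * j + 1..<6 * j + 5]"
  have "g j \<noteq> []" using g[OF assms] l by auto
  then have "hd ?C = ?q" using g[OF assms] by (simp add: hd_map)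
  have C: "block j = (?p # ?C) @ ?Z" using block_mid[OF assms] by simp
  have "?Z \<noteq> []" by simp
  then have "wedges (block j) = insert {?q, zig (6 * j + 1)} (wedges (?p # ?C) \<union> wedges ?Z)"
    unfolding C by (subst wedges_append) (simp_all add: upt_conv_Cons)
  also have "wedges (?p # ?C) = insert {?p, ?q} (wedges ?C)"
    using wedges_Cons[of ?C ?p] \<open>hd ?C = ?q\<close> by simp
  finally have *: "insert {?q, zig (6 * j + 1)} (insert {?p, ?q} (wedges ?C) \<union> wedges ?Z) \<subseteq> wedges walk"
    using wedges_block[of j] assms by simp
  then show "wedges ?Z \<subseteq> wedges walk" "wedges ?C \<subseteq> wedges walk"
    "{?p, ?q} \<in> wedges walk" "{?q, zig (6 * j + 1)} \<in> wedges walk" by blast+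
qed

text \<open>Detour \<open>j\<close> replaces three steps of the zigzag: the layer switch at
  \<open>x (3 * j - 1)\<close>, the edge to \<open>x (3 * j)\<close> and the switch there. All other
  steps survive.\<close>

lemma walk_zig:
  assumes "t < 2 * A" "\<And>j. 1 \<le> j \<Longrightarrow> j < h \<Longrightarrow> t \<notin> {6 * j - 2, 6 * j - 1, 6 * j}"
  shows "{zig t, zig (Suc t)} \<in> wedges walk"
proof -
  define j where "j = t div 6"
  have t: "6 * j \<le> t" "t < 6 * j + 6" unfolding j_def by presburger+
  \<comment> \<open>In order: the last block, block \<open>0\<close>, the joint before the last
    block, and the zigzag part of a middle block.\<close>
  consider "6 * h - 1 \<le> t" | "t + 1 < 5" | "t = 6 * h - 2"
    | "1 \<le> j" "j < h" "6 * j + 1 \<le> t" "t < 6 * j + 4"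
  proof -
    have "j < h \<or> 6 * h - 1 \<le> t" using t by linarith
    moreover have "t < 6 * j + 4 \<or> 6 * h - 2 \<le> t"
    proof (rule ccontr)
      assume "\<not> ?thesis"
      then have "1 \<le> Suc j" "Suc j < h" "t \<in> {6 * Suc j - 2, 6 * Suc j - 1, 6 * Suc j}" using t by auto
      then show False using assms(2) by blast
    qed
    moreover have "j = 0 \<or> h \<le> j \<or> t \<noteq> 6 * j" using assms(2)[of j] by force
    ultimately have "6 * h - 1 \<le> t \<or> t + 1 < 5 \<or> t = 6 * h - 2 \<or>
        1 \<le> j \<and> j < h \<and> 6 * j + 1 \<le> t \<and> t < 6 * j + 4"
      using t by linarith
    then show thesis using that by blast
  qed
  then show ?thesis
  proof cases
    case 1
    then have "{zig t, zig (Suc t)} \<in> wedges (block h)"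
      unfolding block_h using assms(1) by (intro zig_edge) auto
    then show ?thesis using wedges_block[of h] by blast
  next
    case 2
    then have "{zig t, zig (Suc t)} \<in> wedges (block 0)" unfolding block_0 by (intro zig_edge) auto
    then show ?thesis using wedges_block[of 0] by blast
  next
    case 3
    have "last (block (h - 1)) = zig (6 * (h - 1) + 4)" using h by (simp add: last_block)
    moreover have "6 * (h - 1) + 4 = t" using 3 h by linarith
    moreover have "hd (block h) = zig (6 * h - 1)" using A h by (simp add: block_h hd_map del: upt_Suc)
    moreover have "6 * h - 1 = Suc t" using 3 h by linarith
    ultimately show ?thesis using wedges_junction[of "h - 1"] h by simp
  next
    case 4
    then have "{zig t, zig (Suc t)} \<in> wedges (map zig [6 * j + 1..<6 * j + 5])"
      by (intro zig_edge) auto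
    then show ?thesis using wedges_mid(1)[OF 4(1,2)] by blast
  qed
qed

lemma walk_cycle_edge:
  assumes "i < A" shows "\<exists>q<4. {(x i, q), (x (Suc i), q)} \<in> wedges walk"
proof (cases "\<exists>j. 1 \<le> j \<and> j < h \<and> i = 3 * j - 1")
  case True
  then obtain j where j: "1 \<le> j" "j < h" "i = 3 * j - 1" by blast
  then have "{(x i, side j), (x (Suc i), side j)} \<in> wedges walk" using wedges_mid(3)[of j] by simp
  moreover have "side j < 4" by (simp add: side_def)
  ultimately show ?thesis by blast
next
  case False
  have "{zig (2 * i + 1), zig (Suc (2 * i + 1))} \<in> wedges walk"
  proof (rule walk_zig)
    fix j assume j: "1 \<le> j" "j < h"
    then have "i \<noteq> 3 * j - 1" using False by blast
    then show "2 * i + 1 \<notin> {6 * j - 2, 6 * j - 1, 6 * j}" using j by auto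
  qed (use assms in simp)
  moreover have "zig (2 * i + 1) = (x i, if even (Suc i) then 2 else 1)"
    "zig (Suc (2 * i + 1)) = (x (Suc i), if even (Suc i) then 2 else 1)"
    by (simp_all add: zig_def)
  ultimately show ?thesis by (metis one_less_numeral_iff numeral_less_iff semiring_norm(76,78))
qed

text \<open>At the two ends of a detour the rung connects the zigzag with an outer layer; elsewhere
  it is the layer switch of the zigzag.\<close>

lemma walk_rung:
  assumes "i < A"
  shows "\<exists>q q'. q < 4 \<and> q' < 4 \<and> (q' = Suc q \<or> q = Suc q') \<and> {(x i, q), (x i, q')} \<in> wedges walk"
proof -
  consider j where "1 \<le> j" "j < h" "i = 3 * j - 1" | j where "1 \<le> j" "j < h" "i = 3 * j"
    | "\<And>j. 1 \<le> j \<Longrightarrow> j < h \<Longrightarrow> i \<noteq> 3 * j - 1 \<and> i \<noteq> 3 * j" by blast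
  then show ?thesis
  proof cases
    case (1 j)
    have "last (block (j - 1)) = zig (6 * (j - 1) + 4)"
      using 1 by (simp add: last_block)
    moreover have "6 * (j - 1) + 4 = 2 * i" using 1 by linarith
    moreover have "zig (2 * i) = (x i, if even i then 2 else 1)" by (simp add: zig_def)
    moreover have "hd (block j) = (x i, side j)" using block_mid[of j] 1 by simp
    ultimately have "{(x i, if even i then 2 else 1), (x i, side j)} \<in> wedges walk"
      using wedges_junction[of "j - 1"] 1 by simp
    moreover have "even i = odd j" using 1 by presburger
    ultimately show ?thesis
      by (intro exI[of _ "if even i then 2 else 1"] exI[of _ "side j"]) (auto simp: side_def)
  next
    case (2 j)
    have "zig (6 * j + 1) = (x i, if even j then 1 else 2)"
    proof -
      have "(6 * j + 1) div 2 = i" "even ((6 * j + 1 + 1) div 2) = odd j" using 2 by presburger+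
      then show ?thesis by (simp add: zig_def)
    qed
    then have "{(x i, side j), (x i, if even j then 1 else 2)} \<in> wedges walk"
      using wedges_mid(4)[of j] 2 by simp
    then show ?thesis
      by (intro exI[of _ "side j"] exI[of _ "if even j then 1 else 2"]) (auto simp: side_def)
  next
    case 3
    have "{zig (2 * i), zig (Suc (2 * i))} \<in> wedges walk"
    proof (rule walk_zig)
      fix j assume j: "1 \<le> j" "j < h"
      then show "2 * i \<notin> {6 * j - 2, 6 * j - 1, 6 * j}" using 3[OF j] by auto
    qed (use assms in simp)
    moreover have "zig (2 * i) = (x i, if even i then 2 else 1)"
      "zig (Suc (2 * i)) = (x i, if even i then 1 else 2)"
      by (simp_all add: zig_def)
    ultimately show ?thesis
      by (intro exI[of _ "if even i then 2 else 1"] exI[of _ "if even i then 1 else 2"]) auto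
  qed
qed

lemma walk_loop_edge:
  assumes "1 \<le> j" "j < h" "{a, b} \<in> cedges (g j)"
  shows "{(a, side j), (b, side j)} \<in> wedges walk"
proof -
  have ne: "g j \<noteq> []" using g[OF assms(1,2)] l by auto
  have hd: "hd (g j) = x (3 * j)" using g[OF assms(1,2)] by blast
  have "{(a, side j), (b, side j)} = (\<lambda>v. (v, side j)) ` {a, b}" by simp
  also have "\<dots> \<in> (`) (\<lambda>v. (v, side j)) ` cedges (g j)" using assms(3) by blast
  also have "\<dots> = wedges (map (\<lambda>v. (v, side j)) (g j) @ [(x (3 * j), side j)])"
    using ne hd cedges_conv_wedges[of "map (\<lambda>v. (v, side j)) (g j)"] by (simp add: cedges_map hd_map)
  finally show ?thesis using wedges_mid(2)[OF assms(1,2)] by blast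
qed

end

text \<open>If \<open>v\<close> is met in the first half of the turn from \<open>u\<close>, reversal
  moves it to the second half.\<close>

lemma ham_far_orientation:
  assumes "ham k H" "length u = k" "u \<noteq> v"
  obtains G where "ham k G" "cedges G = cedges H" "hd G = u"
    "\<And>D. D < 2 ^ k \<Longrightarrow> G ! D = v \<Longrightarrow> 2 ^ k \<le> 2 * D"
proof -
  obtain G where G: "ham k G" "cedges G = cedges H" "hd G = u"
    using ham_rotate_to_hd[OF assms(1,2)] .
  have len: "length G = 2 ^ k" using ham_length G(1) .
  have G0: "G ! 0 = u" using G ham_nonempty by (metis hd_conv_nth)
  have inj: "D = D'" if "ham k Z" "D < 2 ^ k" "D' < 2 ^ k" "Z ! D = Z ! D'" for Z D D'
    using that ham_length[of k Z] by (simp add: ham_def nth_eq_iff_index_eq)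
  show thesis
  proof (cases "\<exists>D<2 ^ k. G ! D = v \<and> 2 * D < 2 ^ k")
    case False
    then show thesis using that[OF G] by (meson not_less)
  next
    case True
    then obtain D where D: "D < 2 ^ k" "G ! D = v" "2 * D < 2 ^ k" by blast
    have "0 < D" using D(2) G0 assms(3) by (cases D) auto
    obtain G' where G': "ham k G'" "cedges G' = cedges G" "G' ! 0 = G ! 0"
      "0 < D \<Longrightarrow> G' ! (length G - D) = G ! D"
      using ham_reflect[OF G(1), of D] D(1) len by metis
    show thesis
    proof (rule that)
      show "ham k G'" "cedges G' = cedges H" using G' G by simp_all
      show "hd G' = u" using G'(1,3) G0 ham_nonempty by (metis hd_conv_nth)
      fix E assume E: "E < 2 ^ k" "G' ! E = v"
      have "G' ! (2 ^ k - D) = v" using G'(4) \<open>0 < D\<close> len D(2) by simp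
      then have "E = 2 ^ k - D" using inj[OF G'(1), of E "2 ^ k - D"] E \<open>0 < D\<close> by simp
      then show "2 ^ k \<le> 2 * E" using D(3) by linarith
    qed
  qed
qed

section \<open>Divisibility, and cutting Hamiltonian cycles\<close>

lemma power2_times_odd:
  assumes "0 < (l::nat)" obtains b d where "l = 2 ^ b * d" "odd d"
proof -
  have "\<exists>b d. l = 2 ^ b * d \<and> odd d" using assms
  proof (induction l rule: less_induct)
    case (less l)
    show ?case
    proof (cases "odd l")
      case True then show ?thesis by (intro exI[of _ 0] exI[of _ l]) simp
    next
      case False
      then obtain k where k: "l = 2 * k" by blast
      then obtain b d where "k = 2 ^ b * d" "odd d" using less.IH[of k] less.prems by auto
      then show ?thesis using k by (intro exI[of _ "Suc b"] exI[of _ d]) simp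
    qed
  qed
  then show thesis using that by blast
qed

text \<open>The odd part of \<open>l\<close> is coprime to \<open>2 ^ n\<close> and so divides
  \<open>N\<close>. The power of 2 in \<open>l\<close> is at most \<open>l\<close>, and
  \<open>N \<ge> 2\<close> forces it to be at most \<open>2 ^ (n - 2)\<close>.\<close>

lemma dvd_quarter:
  fixes l N n :: nat
  assumes "l dvd N * 2 ^ n" "N * l \<le> 2 ^ (n - 1)" "2 \<le> N" "0 < l" "2 \<le> n"
  shows "l dvd N * 2 ^ (n - 2)"
proof -
  obtain b d where bd: "l = 2 ^ b * d" "odd d" using power2_times_odd assms(4) .
  have "b < n - 1"
  proof (rule ccontr)
    assume "\<not> b < n - 1"
    then have "2 ^ (n - 1) \<le> (2::nat) ^ b" by simp
    also have "2 ^ b \<le> l" using bd by (cases d) auto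
    finally have "2 * 2 ^ (n - 1) \<le> N * l" using assms(3) by (rule mult_le_mono[rotated])
    moreover have "0 < (2::nat) ^ (n - 1)" by simp
    ultimately show False using assms(2) by linarith
  qed
  then have "b \<le> n - 2" by simp
  then have "(2::nat) ^ b dvd 2 ^ (n - 2)" by (rule le_imp_power_dvd)
  moreover have "d dvd N"
  proof -
    have "coprime d (2 ^ n)" using bd(2) by (simp add: coprime_commute)
    moreover have "d dvd N * 2 ^ n" using assms(1) bd(1) by (metis dvd_mult_right)
    ultimately show ?thesis by (simp add: coprime_dvd_mult_left_iff)
  qed
  ultimately show ?thesis unfolding bd(1) by (metis mult.commute mult_dvd_mono)
qed

text \<open>A closed Hamiltonian cycle read as a walk repeats only its first vertex, after
  \<open>2 ^ n > l\<close> steps.\<close>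

lemma path_decomposition_from_ham_cycles:
  assumes "even n" "0 < n" "0 < l" "l dvd 2 ^ n" "l < 2 ^ n"
  shows "\<exists>\<P>. edge_decomposition (hypercube n) \<P> \<and> (\<forall>P\<in>\<P>. is_path l P)"
proof -
  obtain L where L: "ham_decomposition n L" using hypercube_ham_decomposition assms(1,2) .
  then have L': "length L = n div 2" "\<And>c. c < n div 2 \<Longrightarrow> ham n (L ! c)"
    by (simp_all add: ham_decomposition_def)
  define W where "W c = L ! c @ [hd (L ! c)]" for c
  show ?thesis
  proof (rule walks_imp_path_decomposition[OF assms(3,4)])
    show "length (W c) = Suc (2 ^ n)" if "c < n div 2" for c
      using ham_length[OF L'(2)[OF that]] by (simp add: W_def)
    show "W c ! i \<noteq> W c ! j" if c: "c < n div 2" and ij: "i < j" "j \<le> i + l" "j \<le> 2 ^ n" for c i j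
    proof
      assume eq: "W c ! i = W c ! j"
      have H: "distinct (L ! c)" "length (L ! c) = 2 ^ n" "L ! c \<noteq> []"
        using L'(2)[OF c] ham_length ham_nonempty by (auto simp: ham_def)
      define j' where "j' = (if j < 2 ^ n then j else 0)"
      have "W c ! j = L ! c ! j'"
        using H ij by (auto simp: W_def j'_def nth_append hd_conv_nth)
      moreover have "W c ! i = L ! c ! i" using H ij by (simp add: W_def nth_append)
      moreover have "i < length (L ! c)" "j' < length (L ! c)" using H(2) ij by (simp_all add: j'_def)
      ultimately have "i = j'" using eq H(1) nth_eq_iff_index_eq by metis
      then show False using ij assms(5) by (simp add: j'_def split: if_splits)
    qed
    show "edges (hypercube n) \<subseteq> (\<Union>c<n div 2. wedges (W c))"
    proof
      fix e assume "e \<in> edges (hypercube n)"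
      then obtain H where "H \<in> set L" "e \<in> cedges H" using L by (auto simp: ham_decomposition_def)
      then obtain c where "c < n div 2" "e \<in> cedges (L ! c)" using L'(1) by (metis in_set_conv_nth)
      then show "e \<in> (\<Union>c<n div 2. wedges (W c))"
        using cedges_conv_wedges[OF ham_nonempty[OF L'(2)]] by (auto simp: W_def)
    qed
    obtain k where "n = 2 * k" using assms(1) by blast
    then show "card (edges (hypercube n)) = n div 2 * 2 ^ n"
      using assms(2) by (cases k) (simp_all add: card_edges_hypercube)
  qed (rule Union_edges_hypercube[OF assms(2)])
qed

text \<open>Taking the index modulo 4 turns rotation of the 4-cycle into addition to the layer
  number, and \<open>square 4\<close> closes the cycle.\<close>

definition square :: "nat \<Rightarrow> bool list" where
  "square q = [[False, False], [True, False], [True, True], [False, True]] ! (q mod 4)"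

lemma square_inj: "square q = square q' \<longleftrightarrow> q mod 4 = q' mod 4"
proof -
  have "q mod 4 = 0 \<or> q mod 4 = 1 \<or> q mod 4 = 2 \<or> q mod 4 = 3"
    "q' mod 4 = 0 \<or> q' mod 4 = 1 \<or> q' mod 4 = 2 \<or> q' mod 4 = 3" by presburger+
  then show ?thesis unfolding square_def by (elim disjE) (simp_all add: numeral_2_eq_2 numeral_3_eq_3)
qed

lemma length_square: "length (square q) = 2"
proof -
  have "q mod 4 = 0 \<or> q mod 4 = 1 \<or> q mod 4 = 2 \<or> q mod 4 = 3" by presburger
  then show ?thesis unfolding square_def by (elim disjE) (simp_all add: numeral_2_eq_2 numeral_3_eq_3)
qed

lemma square_simps: "square 0 = [False, False]" "square 1 = [True, False]" "square 2 = [True, True]"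
    "square 3 = [False, True]" "square 4 = [False, False]"
  by (simp_all add: square_def)

lemma square_surj:
  assumes "length b = 2" obtains q where "b = square q"
proof -
  have "b = square 0 \<or> b = square 1 \<or> b = square 2 \<or> b = square 3"
    using assms lists_length_2 unfolding square_simps by auto
  then show thesis using that by blast
qed

lemma square_edges:
  assumes "{b, b'} \<in> edges (hypercube 2)" obtains q where "{b, b'} = {square q, square (Suc q)}"
proof -
  let ?C = "[[False, False], [True, False], [True, True], [False, True]]"
  have "{b, b'} \<in> cedges ?C"
    using assms ham_decomposition_2 by (auto simp: ham_decomposition_def)
  moreover have "cedges ?C = {{square 3, square 4}, {square 0, square 1}, {square 1, square 2},
      {square 2, square 3}}"
    unfolding cedges_def square_simps by simp
  ultimately have "{b, b'} \<in> {{square 3, square 4}, {square 0, square 1}, {square 1, square 2},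
      {square 2, square 3}}" by (simp only:)
  then have "{b, b'} = {square 0, square 1} \<or> {b, b'} = {square 1, square 2} \<or>
      {b, b'} = {square 2, square 3} \<or> {b, b'} = {square 3, square 4}"
    unfolding insert_iff empty_iff by argo
  then have "{b, b'} = {square 0, square (Suc 0)} \<or> {b, b'} = {square 1, square (Suc 1)} \<or>
      {b, b'} = {square 2, square (Suc 2)} \<or> {b, b'} = {square 3, square (Suc 3)}"
    by (simp add: numeral_2_eq_2 numeral_3_eq_3 numeral_Bit0)
  then show thesis using that by blast
qed

lemma path_decomposition_from_walks:
  assumes n: "even n" "6 \<le> n" and l_pos: "0 < l" and l_le: "2 * l \<le> 2 ^ (n - 2)"
    and dvd: "l dvd (n div 2) * 2 ^ (n - 2)"
  shows "\<exists>\<P>. edge_decomposition (hypercube n) \<P> \<and> (\<forall>P\<in>\<P>. is_path l P)"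
proof -
  define k where "k = n - 2"
  define h where "h = k div 2"
  have nk: "n = k + 2" and k: "even k" "0 < k" and kh: "k = 2 * h" and h: "2 \<le> h"
    using n by (auto simp: k_def h_def)
  obtain L where L: "ham_decomposition k L" using hypercube_ham_decomposition k .
  then have L': "length L = h" "\<And>j. j < h \<Longrightarrow> ham k (L ! j)"
    by (simp_all add: ham_decomposition_def h_def)
  \<comment> \<open>Cycle \<open>0\<close> guides the walk; the other \<open>h - 1\<close> cycles
    become its detours.\<close>
  define x where "x i = L ! 0 ! (i mod 2 ^ k)" for i
  have H0: "ham k (L ! 0)" "length (L ! 0) = 2 ^ k" "L ! 0 \<noteq> []"
    using L'(2)[of 0] h ham_length ham_nonempty by auto
  have x_inj: "inj_on x {..<2 ^ k}"
    using H0 by (auto simp: x_def ham_def inj_on_def nth_eq_iff_index_eq)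
  have x_len: "length (x i) = k" for i
  proof -
    have "x i \<in> set (L ! 0)" unfolding x_def using H0(2) by (intro nth_mem) simp
    then show ?thesis using H0(1) by (simp add: ham_def)
  qed
  have x_surj: "\<exists>i<2 ^ k. x i = a" if "length a = k" for a
  proof -
    have "a \<in> set (L ! 0)" using that H0 by (simp add: ham_def)
    then show ?thesis using H0(2) by (metis in_set_conv_nth mod_less x_def)
  qed
  \<comment> \<open>There is room on the guiding cycle for detours three vertices apart.\<close>
  have big: "3 * h \<le> 2 ^ k"
  proof -
    have "3 * i \<le> (4::nat) ^ i" for i
    proof (induction i)
      case (Suc i)
      have "1 \<le> (4::nat) ^ i" by simp
      then have "3 * i + 3 \<le> 4 ^ i + 3 * 4 ^ i" using Suc by linarith
      then show ?case by simp
    qed simp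
    from this[of h] have "3 * h \<le> (4::nat) ^ h" .
    then show ?thesis by (simp add: kh power_mult)
  qed
  have "\<exists>G. 1 \<le> j \<and> j < h \<longrightarrow> ham k G \<and> cedges G = cedges (L ! j) \<and> hd G = x (3 * j) \<and>
      (\<forall>D<2 ^ k. G ! D = x (3 * j - 1) \<longrightarrow> 2 ^ k \<le> 2 * D)" for j
  proof (cases "1 \<le> j \<and> j < h")
    case True
    then have "3 * j < 2 ^ k" "3 * j - 1 < 2 ^ k" "3 * j \<noteq> 3 * j - 1" using big by linarith+
    then have "x (3 * j) \<noteq> x (3 * j - 1)" using x_inj by (auto simp: inj_on_def)
    then show ?thesis using ham_far_orientation[OF L'(2) x_len, of j "3 * j" "x (3 * j - 1)"] True by metis
  qed blast
  then obtain g where loops: "\<And>j. 1 \<le> j \<Longrightarrow> j < h \<Longrightarrow> ham k (g j) \<and> cedges (g j) = cedges (L ! j) \<and>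
      hd (g j) = x (3 * j) \<and> (\<forall>D<2 ^ k. g j ! D = x (3 * j - 1) \<longrightarrow> 2 ^ k \<le> 2 * D)" by metis
  interpret hypercube_walk "2 ^ k" h l x g
  proof
    show "even ((2::nat) ^ k)" using k by simp
    show "l < 2 ^ k" using l_pos l_le by (simp add: k_def)
    show "l \<le> D" if "1 \<le> j" "j < h" "D < 2 ^ k" "g j ! D = x (3 * j - 1)" for j D
    proof -
      have "2 ^ k \<le> 2 * D" using loops that by blast
      then show ?thesis using l_le by (simp add: k_def)
    qed
    show "distinct (g j) \<and> length (g j) = 2 ^ k \<and> hd (g j) = x (3 * j)" if "1 \<le> j" "j < h" for j
      using loops[OF that] ham_length by (auto simp: ham_def)
  qed (use big h x_inj in \<open>simp_all add: x_def\<close>)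
  define emb where "emb c = (\<lambda>(v, q). v @ square (q + c))" for c
  have emb_inj: "inj_on (emb c) (UNIV \<times> {..<4})" for c
  proof (rule inj_onI, clarsimp)
    fix v q v' q' assume *: "q < 4" "q' < (4::nat)" "emb c (v, q) = emb c (v', q')"
    then have "v = v'" "square (q + c) = square (q' + c)"
      by (simp_all add: emb_def append_eq_append_conv length_square)
    moreover from this have "q mod 4 = q' mod 4"
      using square_inj add_left_mod_cancel[of c q 4 q'] by (simp add: add.commute)
    ultimately show "v = v' \<and> q = q'" using * by simp
  qed
  have layers: "set walk \<subseteq> UNIV \<times> {..<4}"
  proof -
    have "set (block j) \<subseteq> UNIV \<times> {..<4}" for j
      using zig_layer by (auto simp: block_def side_def zig_def)
    then show ?thesis unfolding walk_def by fastforce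
  qed
  define W where "W c = map (emb c) walk" for c
  have edge: "{v @ square d, v' @ square d'} \<in> (\<Union>c<4. wedges (W c))"
    if "{(v, q), (v', q')} \<in> wedges walk" "d + q' = d' + q" "q \<le> d + 4" for v v' q q' d d'
  proof -
    \<comment> \<open>This is the translate that carries layer \<open>q\<close> to layer
      \<open>d\<close>; adding 4 avoids truncated subtraction.\<close>
    define c where "c = (d + 4 - q) mod 4"
    have "{emb c (v, q), emb c (v', q')} \<in> wedges (W c)"
      using that(1) by (auto simp: W_def wedges_map image_iff intro!: bexI[of _ "{(v, q), (v', q')}"])
    moreover have "square (q + c) = square d" "square (q' + c) = square d'"
    proof -
      have "q + (d + 4 - q) = d + 4" "q' + (d + 4 - q) = d' + 4" using that(2,3) by linarith+
      then have "(q + c) mod 4 = d mod 4" "(q' + c) mod 4 = d' mod 4"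
        unfolding c_def by (simp_all add: mod_add_right_eq)
      then show "square (q + c) = square d" "square (q' + c) = square d'"
        using square_inj by blast+
    qed
    moreover have "c < 4" by (simp add: c_def)
    ultimately show ?thesis by (auto simp: emb_def)
  qed
  have nh: "n div 2 = h + 1" using nk kh by simp
  show ?thesis
  proof (rule walks_imp_path_decomposition)
    show "0 < l" by (rule l_pos)
    show "l dvd (h + 1) * 2 ^ k" using dvd unfolding nh k_def[symmetric] .
    show "length (W c) = Suc ((h + 1) * 2 ^ k)" for c by (simp add: W_def length_walk)
    show "W c ! i \<noteq> W c ! j" if "i < j" "j \<le> i + l" "j \<le> (h + 1) * 2 ^ k" for c i j
    proof -
      have "separated l (W c)" unfolding W_def
        using separated_walk inj_on_subset[OF emb_inj layers] by (rule separated_map)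
      then have "l < j - i" if "W c ! i = W c ! j"
        using that \<open>i < j\<close> \<open>j \<le> (h + 1) * 2 ^ k\<close> length_walk by (simp add: separated_def W_def)
      then show ?thesis using \<open>j \<le> i + l\<close> by fastforce
    qed
    show "card (edges (hypercube n)) = 4 * ((h + 1) * 2 ^ k)"
      by (simp add: card_edges_hypercube nk kh algebra_simps)
    show "\<Union> (edges (hypercube n)) = verts (hypercube n)"
      using Union_edges_hypercube n by simp
    show "edges (hypercube n) \<subseteq> (\<Union>c<4. wedges (W c))"
    proof
      fix e assume "e \<in> edges (hypercube n)"
      then have "e \<in> edges (hypercube (k + 2))" using nk by simp
      then show "e \<in> (\<Union>c<4. wedges (W c))"
      proof (cases rule: edge_hypercube_appendE)
        case (left a a' b)
        obtain d where d: "b = square d" using square_surj left(3) .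
        obtain H where "H \<in> set L" "{a, a'} \<in> cedges H" using L left(2) by (auto simp: ham_decomposition_def)
        then obtain j where j: "j < h" "{a, a'} \<in> cedges (L ! j)" using L'(1) by (metis in_set_conv_nth)
        have "\<exists>q<4. {(a, q), (a', q)} \<in> wedges walk"
        proof (cases "j = 0")
          case True
          then obtain i where i: "i < 2 ^ k" "{a, a'} = {x i, x (Suc i)}"
            using j H0 by (auto simp: cedges_conv_nth x_def)
          obtain q where q: "q < 4" "{(x i, q), (x (Suc i), q)} \<in> wedges walk"
            using walk_cycle_edge[OF i(1)] by blast
          have "{(a, q), (a', q)} = (\<lambda>v. (v, q)) ` {a, a'}" by simp
          also have "\<dots> = {(x i, q), (x (Suc i), q)}" by (simp add: i(2))
          finally show ?thesis using q by metis
        next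
          case False
          then have j1: "1 \<le> j" by simp
          then have "{(a, side j), (a', side j)} \<in> wedges walk"
            using walk_loop_edge[OF j1 j(1)] loops[OF j1 j(1)] j(2) by metis
          moreover have "side j < 4" by (simp add: side_def)
          ultimately show ?thesis by blast
        qed
        then show ?thesis using edge[of a _ a' _ d d] left(1) d by fastforce
      next
        case (right a b b')
        obtain d where d: "{b, b'} = {square d, square (Suc d)}" using square_edges right(3) .
        obtain i where i: "i < 2 ^ k" "x i = a" using x_surj right(2) by blast
        obtain q q' where q: "q < 4" "q' < 4" "q' = Suc q \<or> q = Suc q'"
          "{(a, q), (a, q')} \<in> wedges walk"
          using walk_rung[OF i(1)] i(2) by blast
        have "e = (\<lambda>b. a @ b) ` {b, b'}" using right(1) by simp
        then have e: "e = {a @ square d, a @ square (Suc d)}" by (simp add: d)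
        from q(3) show ?thesis
        proof
          assume "q' = Suc q"
          then show ?thesis using edge[of a q a q' d "Suc d"] q e by simp
        next
          assume "q = Suc q'"
          then show ?thesis using edge[of a q a q' "Suc d" d] q e by (simp add: insert_commute)
        qed
      qed
    qed
  qed
qed

theorem theorem3:
  fixes n l :: nat
  assumes "even n" and "n > 0" and "l > 0"
    and "real l \<le> 2 ^ n / real n"
    and "l dvd card (edges (hypercube n))"
  shows "\<exists>\<P>. edge_decomposition (hypercube n) \<P> \<and> (\<forall>P\<in>\<P>. is_path l P)"
proof -
  have "real (n * l) \<le> real (2 ^ n)" using assms(2,4) by (simp add: field_simps)
  then have nl: "n * l \<le> 2 ^ n" by (simp only: of_nat_le_iff)
  obtain N where N: "n = 2 * N" using assms(1) by blast
  have dvd: "l dvd n * 2 ^ (n - 1)" using assms(5) by (simp add: card_edges_hypercube)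
  consider "n = 2" | "n = 4" | "6 \<le> n" using assms(1,2) by (auto elim!: evenE) linarith
  then show ?thesis
  proof cases
    case 1
    then have "l = 1 \<or> l = 2" using nl assms(3) by auto
    then show ?thesis using 1 by (intro path_decomposition_from_ham_cycles) auto
  next
    case 2
    then have "l \<le> 4" using nl by simp
    \<comment> \<open>Divisibility of 32 excludes 3, and the other values divide 16.\<close>
    then have "l \<in> {1, 2, 3, 4}" using assms(3) by auto
    moreover have "l dvd 32" using dvd 2 by simp
    ultimately have "l dvd 2 ^ n" "l < 2 ^ n" using 2 by auto
    then show ?thesis using assms by (intro path_decomposition_from_ham_cycles)
  next
    case 3
    have "n * 2 ^ (n - 1) = N * 2 ^ n" using N 3 by (cases N) simp_all
    then have dvdN: "l dvd N * 2 ^ n" using dvd by simp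
    have pow: "(2::nat) ^ n = 4 * 2 ^ (n - 2)" "(2::nat) ^ n = 2 * 2 ^ (n - 1)"
    proof -
      obtain m where "n = 2 + m" using 3 le_Suc_ex[of 2 n] by auto
      then show "(2::nat) ^ n = 4 * 2 ^ (n - 2)" "(2::nat) ^ n = 2 * 2 ^ (n - 1)" by simp_all
    qed
    have "N * l \<le> 2 ^ (n - 1)" using nl N pow(2) by simp
    then have d: "l dvd (n div 2) * 2 ^ (n - 2)"
      using dvd_quarter[OF dvdN] N 3 assms(3) by simp
    \<comment> \<open>For \<open>n = 6\<close> the bound gives only \<open>l \<le> 10\<close> where
      \<open>l \<le> 8\<close> is wanted, but 9 and 10 do not divide the number 192 of edges. From
      \<open>n = 8\<close> on, \<open>8 * l \<le> n * l\<close> suffices.\<close>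
    have "2 * l \<le> 2 ^ (n - 2)"
    proof (cases "n = 6")
      case True
      then have "l \<le> 10" "l dvd 192" using nl dvdN N by auto
      then have "l \<noteq> 9" "l \<noteq> 10" by auto
      then show ?thesis using True \<open>l \<le> 10\<close> by simp
    next
      case False
      then have "8 \<le> n" using N 3 by presburger
      then have "8 * l \<le> n * l" by simp
      then show ?thesis using nl pow(1) by linarith
    qed
    then show ?thesis using path_decomposition_from_walks[OF assms(1) 3 assms(3) _ d] by blast
  qed
qed

end
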